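(* Assume that the spectrum of $H^D_{(a,c)}$ is purely discrete, and let $\phi(z,x)$, $\theta(z,x)$ be a system of real entire solutions with $\phi(z,\cdot)$ in the domain of $H$ near $a$ and $W(\theta(z),\phi(z))=1$. Then the singular Weyl $m$-function $$M(z)=-\frac{W(\theta(z),u_+(z))}{W(\phi(z),u_+(z))}$$ is analytic in $\mathbb{C}\setminus\mathbb{R}$ and satisfies $M(z)=M(z^* )^*$.
   Context: Let $-\infty\le a<b\le\infty$, let $q\in L^1_{\mathrm{loc}}(a,b)$ be real-valued, $\tau=-\frac{d^2}{dx^2}+q$, and let $H$ be a self-adjoint operator in $L^2(a,b)$ associated with $\tau$ with separated boundary conditions at $a$ and/or $b$. A solution lies in the domain of $H$ near $a$ (resp. $b$) if it is square integrable near that endpoint and satisfies the boundary condition of $H$ there in case $\tau$ is limit circle at that endpoint. Fix $c\in(a,b)$; $H^D_{(a,c)}$, $H^D_{(c,b)}$ are the restrictions of $H$ to $(a,c)$, $(c,b)$ with a Dirichlet boundary condition at $c$. $W(u,v)=uv'-u'v$ is the Wronskian and $z^*$ denotes complex conjugation. "Real entire solutions" means that for every $z\in\mathbb{C}$ the functions $\phi(z,\cdot)$, $\theta(z,\cdot)$ solve $\tau u=zu$, and for every $x\in(a,b)$ they (and their $x$-derivatives) are entire in $z$ and real for $z\in\mathbb{R}$. With $c(z,x)$, $s(z,x)$ the solutions of $\tau u=zu$ satisfying $c(z,c)=1,\ c'(z,c)=0,\ s(z,c)=0,\ s'(z,c)=1$, the Weyl solution is $u_+(z,x)=c(z,x)+m_+(z)s(z,x)$,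 $z\in\mathbb{C}\setminus\sigma(H^D_{(c,b)})$, where $m_+$ is the Weyl $m$-function of $H^D_{(c,b)}$, i.e. $u_+(z,\cdot)$ lies in the domain of $H$ near $b$; $m_+$ is analytic in $\mathbb{C}\setminus\mathbb{R}$ with $m_+(z^* )^*=m_+(z)$. *)

theory Defs
  imports "HOL-Analysis.Analysis"
begin

section \<open>The space $L^2(a,b)$ and operators in it\<close>

text \<open>Elements of $L^2(a,b)$ are represented by functions on the reals whose values outside
  $(a,b)$ are irrelevant. Functions that agree almost everywhere are not identified; instead
  operators are represented by graphs (sets of pairs of representatives).\<close>

definition L2 :: "ereal \<Rightarrow> ereal \<Rightarrow> (real \<Rightarrow> complex) set" where
  "L2 a b = {f \<in> borel_measurable (lebesgue_on (einterval a b)).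
      integrable (lebesgue_on (einterval a b)) (\<lambda>x. (cmod (f x))\<^sup>2)}"

definition L2_inner :: "ereal \<Rightarrow> ereal \<Rightarrow> (real \<Rightarrow> complex) \<Rightarrow> (real \<Rightarrow> complex) \<Rightarrow> complex" where
  "L2_inner a b f g = (LINT x|lebesgue_on (einterval a b). cnj (f x) * g x)"

definition L2_norm :: "ereal \<Rightarrow> ereal \<Rightarrow> (real \<Rightarrow> complex) \<Rightarrow> real" where
  "L2_norm a b f = sqrt (LINT x|lebesgue_on (einterval a b). (cmod (f x))\<^sup>2)"

definition ae_eq :: "ereal \<Rightarrow> ereal \<Rightarrow> (real \<Rightarrow> complex) \<Rightarrow> (real \<Rightarrow> complex) \<Rightarrow> bool" where
  "ae_eq a b f g \<longleftrightarrow> (AE x in lebesgue_on (einterval a b). f x = g x)"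

type_synonym op_graph = "((real \<Rightarrow> complex) \<times> (real \<Rightarrow> complex)) set"

definition L2_adjoint :: "ereal \<Rightarrow> ereal \<Rightarrow> op_graph \<Rightarrow> op_graph" where
  "L2_adjoint a b A = {(f, g). f \<in> L2 a b \<and> g \<in> L2 a b \<and>
      (\<forall>(u, h)\<in>A. L2_inner a b f h = L2_inner a b g u)}"

definition self_adjoint :: "ereal \<Rightarrow> ereal \<Rightarrow> op_graph \<Rightarrow> bool" where
  "self_adjoint a b A \<longleftrightarrow>
      (\<forall>f\<in>L2 a b. \<forall>\<epsilon>>0. \<exists>(u, h)\<in>A. L2_norm a b (\<lambda>x. f x - u x) < \<epsilon>) \<and>
      L2_adjoint a b A = A"

text \<open>The bound in the resolvent set gives both injectivity of $A - z$ and boundedness of the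
  inverse.\<close>

definition resolvent_set :: "ereal \<Rightarrow> ereal \<Rightarrow> op_graph \<Rightarrow> complex set" where
  "resolvent_set a b A = {z.
      (\<exists>C. \<forall>(f, h)\<in>A. L2_norm a b f \<le> C * L2_norm a b (\<lambda>x. h x - z * f x)) \<and>
      (\<forall>g\<in>L2 a b. \<exists>(f, h)\<in>A. ae_eq a b (\<lambda>x. h x - z * f x) g)}"

definition spectrum :: "ereal \<Rightarrow> ereal \<Rightarrow> op_graph \<Rightarrow> complex set" where
  "spectrum a b A = - resolvent_set a b A"

definition eigenspace :: "op_graph \<Rightarrow> complex \<Rightarrow> (real \<Rightarrow> complex) set" where
  "eigenspace A z = {f. (f, \<lambda>x. z * f x) \<in> A}"

text \<open>Every point of the spectrum is an isolated point of it and an eigenvalue of finite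
  multiplicity, that is, the essential spectrum (of a self-adjoint operator) is empty.\<close>

definition purely_discrete :: "ereal \<Rightarrow> ereal \<Rightarrow> op_graph \<Rightarrow> bool" where
  "purely_discrete a b A \<longleftrightarrow> (\<forall>z\<in>spectrum a b A.
      \<not> z islimpt spectrum a b A \<and>
      (\<exists>f\<in>eigenspace A z. \<not> ae_eq a b f (\<lambda>x. 0)) \<and>
      (\<exists>B. finite B \<and> B \<subseteq> eigenspace A z \<and>
        (\<forall>f\<in>eigenspace A z. \<exists>k. ae_eq a b f (\<lambda>x. \<Sum>e\<in>B. k e * e x))))"


section \<open>The differential expression $\tau = -d^2/dx^2 + q$\<close>

definition loc_integrable :: "ereal \<Rightarrow> ereal \<Rightarrow> (real \<Rightarrow> 'a::euclidean_space) \<Rightarrow> bool" where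
  "loc_integrable a b g \<longleftrightarrow>
      (\<forall>x\<in>einterval a b. \<forall>y\<in>einterval a b. g absolutely_integrable_on {x..y})"

text \<open>\<open>F\<close> is locally absolutely continuous on $(a,b)$ with $F' = G$ almost everywhere, where
  absolutely continuous functions are by definition the indefinite integrals of integrable
  functions.\<close>

definition has_ac_derivative ::
    "ereal \<Rightarrow> ereal \<Rightarrow> (real \<Rightarrow> complex) \<Rightarrow> (real \<Rightarrow> complex) \<Rightarrow> bool" where
  "has_ac_derivative a b F G \<longleftrightarrow> loc_integrable a b G \<and>
      (\<forall>x\<in>einterval a b. \<forall>y\<in>einterval a b. x \<le> y \<longrightarrow> F y - F x = integral {x..y} G)"

abbreviation vderiv :: "(real \<Rightarrow> complex) \<Rightarrow> real \<Rightarrow> complex" where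
  "vderiv u x \<equiv> vector_derivative u (at x)"

text \<open>\<open>u\<close> and \<open>u'\<close> are locally absolutely continuous on $(a,b)$ and $\tau u = g$ almost everywhere.
  Since $u'$ is continuous, \<open>u\<close> is differentiable everywhere.\<close>

definition tau_eq ::
    "ereal \<Rightarrow> ereal \<Rightarrow> (real \<Rightarrow> real) \<Rightarrow> (real \<Rightarrow> complex) \<Rightarrow> (real \<Rightarrow> complex) \<Rightarrow> bool" where
  "tau_eq a b q u g \<longleftrightarrow> (\<forall>x\<in>einterval a b. u differentiable (at x)) \<and>
      has_ac_derivative a b (vderiv u) (\<lambda>x. complex_of_real (q x) * u x - g x)"

definition solution ::
    "ereal \<Rightarrow> ereal \<Rightarrow> (real \<Rightarrow> real) \<Rightarrow> complex \<Rightarrow> (real \<Rightarrow> complex) \<Rightarrow> bool" where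
  "solution a b q z u \<longleftrightarrow> tau_eq a b q u (\<lambda>x. z * u x)"

text \<open>The maximal domain $\mathfrak{D}(\tau)$, consisting of the continuously differentiable
  representatives.\<close>

definition max_domain :: "ereal \<Rightarrow> ereal \<Rightarrow> (real \<Rightarrow> real) \<Rightarrow> (real \<Rightarrow> complex) set" where
  "max_domain a b q = {u \<in> L2 a b. \<exists>g\<in>L2 a b. tau_eq a b q u g}"

definition wronskian :: "(real \<Rightarrow> complex) \<Rightarrow> (real \<Rightarrow> complex) \<Rightarrow> real \<Rightarrow> complex" where
  "wronskian u v x = u x * vderiv v x - vderiv u x * v x"


section \<open>Endpoints and separated boundary conditions\<close>

definition L2_near_left :: "ereal \<Rightarrow> ereal \<Rightarrow> (real \<Rightarrow> complex) \<Rightarrow> bool" where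
  "L2_near_left a b u \<longleftrightarrow> (\<exists>d\<in>einterval a b. u \<in> L2 a (ereal d))"

definition L2_near_right :: "ereal \<Rightarrow> ereal \<Rightarrow> (real \<Rightarrow> complex) \<Rightarrow> bool" where
  "L2_near_right a b u \<longleftrightarrow> (\<exists>d\<in>einterval a b. u \<in> L2 (ereal d) b)"

text \<open>Limit circle: for one (and hence, by Weyl's alternative, for every) \<open>z\<close> all solutions are
  square integrable near the endpoint. In particular, regular endpoints are limit circle.\<close>

definition limit_circle_left :: "ereal \<Rightarrow> ereal \<Rightarrow> (real \<Rightarrow> real) \<Rightarrow> bool" where
  "limit_circle_left a b q \<longleftrightarrow> (\<exists>z. \<forall>u. solution a b q z u \<longrightarrow> L2_near_left a b u)"

definition limit_circle_right :: "ereal \<Rightarrow> ereal \<Rightarrow> (real \<Rightarrow> real) \<Rightarrow> bool" where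
  "limit_circle_right a b q \<longleftrightarrow> (\<exists>z. \<forall>u. solution a b q z u \<longrightarrow> L2_near_right a b u)"

text \<open>$\lim_{x\to a} W(u,v)(x) = 0$ and $\lim_{x\to b} W(u,v)(x) = 0$; the endpoints may be
  infinite, hence the limits are taken in the extended reals.\<close>

definition wronskian_zero_left ::
    "ereal \<Rightarrow> (real \<Rightarrow> complex) \<Rightarrow> (real \<Rightarrow> complex) \<Rightarrow> bool" where
  "wronskian_zero_left a u v \<longleftrightarrow> ((\<lambda>x. wronskian u v (real_of_ereal x)) \<longlongrightarrow> 0) (at_right a)"

definition wronskian_zero_right ::
    "ereal \<Rightarrow> (real \<Rightarrow> complex) \<Rightarrow> (real \<Rightarrow> complex) \<Rightarrow> bool" where
  "wronskian_zero_right b u v \<longleftrightarrow> ((\<lambda>x. wronskian u v (real_of_ereal x)) \<longlongrightarrow> 0) (at_left b)"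

text \<open>A boundary condition at a limit circle endpoint is given by some $v\in\mathfrak{D}(\tau)$ with
  $W_a(v^*,v)=0$ and $W_a(v,f)\neq 0$ for at least one $f\in\mathfrak{D}(\tau)$; it reads
  $W_a(v,u)=0$. At a limit point endpoint there is no condition and \<open>v\<close> plays no role.\<close>

definition bc_function_left ::
    "ereal \<Rightarrow> ereal \<Rightarrow> (real \<Rightarrow> real) \<Rightarrow> (real \<Rightarrow> complex) \<Rightarrow> bool" where
  "bc_function_left a b q v \<longleftrightarrow> (limit_circle_left a b q \<longrightarrow>
      v \<in> max_domain a b q \<and> wronskian_zero_left a (\<lambda>x. cnj (v x)) v \<and>
      (\<exists>f\<in>max_domain a b q. \<not> wronskian_zero_left a v f))"

definition bc_function_right ::
    "ereal \<Rightarrow> ereal \<Rightarrow> (real \<Rightarrow> real) \<Rightarrow> (real \<Rightarrow> complex) \<Rightarrow> bool" where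
  "bc_function_right a b q w \<longleftrightarrow> (limit_circle_right a b q \<longrightarrow>
      w \<in> max_domain a b q \<and> wronskian_zero_right b (\<lambda>x. cnj (w x)) w \<and>
      (\<exists>f\<in>max_domain a b q. \<not> wronskian_zero_right b w f))"

definition bc_left ::
    "ereal \<Rightarrow> ereal \<Rightarrow> (real \<Rightarrow> real) \<Rightarrow> (real \<Rightarrow> complex) \<Rightarrow> (real \<Rightarrow> complex) \<Rightarrow> bool" where
  "bc_left a b q v u \<longleftrightarrow> (limit_circle_left a b q \<longrightarrow> wronskian_zero_left a v u)"

definition bc_right ::
    "ereal \<Rightarrow> ereal \<Rightarrow> (real \<Rightarrow> real) \<Rightarrow> (real \<Rightarrow> complex) \<Rightarrow> (real \<Rightarrow> complex) \<Rightarrow> bool" where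
  "bc_right a b q w u \<longleftrightarrow> (limit_circle_right a b q \<longrightarrow> wronskian_zero_right b w u)"

definition in_domain_near_left ::
    "ereal \<Rightarrow> ereal \<Rightarrow> (real \<Rightarrow> real) \<Rightarrow> (real \<Rightarrow> complex) \<Rightarrow> (real \<Rightarrow> complex) \<Rightarrow> bool" where
  "in_domain_near_left a b q v u \<longleftrightarrow> L2_near_left a b u \<and> bc_left a b q v u"

definition in_domain_near_right ::
    "ereal \<Rightarrow> ereal \<Rightarrow> (real \<Rightarrow> real) \<Rightarrow> (real \<Rightarrow> complex) \<Rightarrow> (real \<Rightarrow> complex) \<Rightarrow> bool" where
  "in_domain_near_right a b q w u \<longleftrightarrow> L2_near_right a b u \<and> bc_right a b q w u"


section \<open>The operators\<close>

text \<open>The graph of $f \mapsto \tau f$ on the functions of $\mathfrak{D}(\tau)$ satisfying the conditions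
  \<open>Ba\<close> and \<open>Bb\<close>. Boundary conditions refer to the continuously differentiable representative
  \<open>u\<close> of \<open>f\<close>.\<close>

definition tau_operator ::
    "ereal \<Rightarrow> ereal \<Rightarrow> (real \<Rightarrow> real) \<Rightarrow> ((real \<Rightarrow> complex) \<Rightarrow> bool) \<Rightarrow> ((real \<Rightarrow> complex) \<Rightarrow> bool)
      \<Rightarrow> op_graph" where
  "tau_operator a b q Ba Bb = {(f, g). f \<in> L2 a b \<and> g \<in> L2 a b \<and>
      (\<exists>u. ae_eq a b f u \<and> tau_eq a b q u g \<and> Ba u \<and> Bb u)}"

definition H_op ::
    "ereal \<Rightarrow> ereal \<Rightarrow> (real \<Rightarrow> real) \<Rightarrow> (real \<Rightarrow> complex) \<Rightarrow> (real \<Rightarrow> complex) \<Rightarrow> op_graph" where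
  "H_op a b q v w = tau_operator a b q (bc_left a b q v) (bc_right a b q w)"

text \<open>The restriction of $H$ to $(a,c)$ with a Dirichlet condition at \<open>c\<close>. An element of its
  domain lives on $(a,c)$ only, so that its value at \<open>c\<close> is a one-sided limit.\<close>

definition H_Dirichlet_left ::
    "ereal \<Rightarrow> ereal \<Rightarrow> (real \<Rightarrow> real) \<Rightarrow> (real \<Rightarrow> complex) \<Rightarrow> real \<Rightarrow> op_graph" where
  "H_Dirichlet_left a b q v c =
      tau_operator a (ereal c) q (bc_left a b q v) (\<lambda>u. (u \<longlongrightarrow> 0) (at_left c))"


section \<open>Weyl functions\<close>

definition real_entire :: "(complex \<Rightarrow> complex) \<Rightarrow> bool" where
  "real_entire F \<longleftrightarrow> F holomorphic_on UNIV \<and> (\<forall>z\<in>\<real>. F z \<in> \<real>)"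

definition real_entire_solution ::
    "ereal \<Rightarrow> ereal \<Rightarrow> (real \<Rightarrow> real) \<Rightarrow> (complex \<Rightarrow> real \<Rightarrow> complex) \<Rightarrow> bool" where
  "real_entire_solution a b q \<phi> \<longleftrightarrow> (\<forall>z. solution a b q z (\<phi> z)) \<and>
      (\<forall>x\<in>einterval a b. real_entire (\<lambda>z. \<phi> z x) \<and> real_entire (\<lambda>z. vderiv (\<phi> z) x))"

text \<open>Below, \<open>C\<close> and \<open>S\<close> are the solutions of $\tau u = zu$ with $C(z,c)=S'(z,c)=1$ and
  $C'(z,c)=S(z,c)=0$. For \<open>z\<close> outside the spectrum of $H^D_{(c,b)}$, in particular for all nonreal
  \<open>z\<close>, there is exactly one \<open>m\<close> as described; elsewhere the value is irrelevant.\<close>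

definition weyl_m ::
    "ereal \<Rightarrow> ereal \<Rightarrow> (real \<Rightarrow> real) \<Rightarrow> (real \<Rightarrow> complex) \<Rightarrow>
      (complex \<Rightarrow> real \<Rightarrow> complex) \<Rightarrow> (complex \<Rightarrow> real \<Rightarrow> complex) \<Rightarrow> complex \<Rightarrow> complex" where
  "weyl_m a b q w C S z = (THE m. in_domain_near_right a b q w (\<lambda>x. C z x + m * S z x))"

definition weyl_solution ::
    "ereal \<Rightarrow> ereal \<Rightarrow> (real \<Rightarrow> real) \<Rightarrow> (real \<Rightarrow> complex) \<Rightarrow>
      (complex \<Rightarrow> real \<Rightarrow> complex) \<Rightarrow> (complex \<Rightarrow> real \<Rightarrow> complex) \<Rightarrow> complex \<Rightarrow> real \<Rightarrow> complex" where
  "weyl_solution a b q w C S z x = C z x + weyl_m a b q w C S z * S z x"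

text \<open>The Wronskian of two solutions for the same \<open>z\<close> is constant; here it is evaluated at \<open>x\<close>.\<close>

definition singular_weyl_m ::
    "(complex \<Rightarrow> real \<Rightarrow> complex) \<Rightarrow> (complex \<Rightarrow> real \<Rightarrow> complex) \<Rightarrow> (complex \<Rightarrow> real \<Rightarrow> complex)
      \<Rightarrow> real \<Rightarrow> complex \<Rightarrow> complex" where
  "singular_weyl_m \<phi> \<theta> u x z = - wronskian (\<theta> z) (u z) x / wronskian (\<phi> z) (u z) x"

end

theory Submission
  imports Defs "HOL-Complex_Analysis.Conformal_Mappings"
begin

text \<open>Functions cut off to zero near \<open>a\<close> satisfy the boundary condition there, so the symmetry of \<open>H\<close>
  turns into Green's identity
  $(\zeta - z^*)\int_c^b u_+(z)^* u_+(\zeta) = m_+(\zeta) - m_+(z)^*$, regardless of whether \<open>b\<close> is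
  limit point or limit circle. It yields the uniqueness, the reflection symmetry and the
  differentiability of $m_+$. Existence of $u_+$ comes from Weyl's nested discs in the limit point
  case, and from the existence of boundary values of Wronskians in the limit circle case. As
  $u_+(z,c) = 1$ and $u_+'(z,c) = m_+(z)$, the function \<open>M\<close> is a quotient of expressions in $m_+(z)$
  with real entire coefficients, evaluated at \<open>c\<close>. A zero of the denominator at a nonreal \<open>z\<close> would
  make $\phi(z)$ an eigenfunction of \<open>H\<close>.\<close>

section \<open>Locally absolutely continuous functions\<close>

text \<open>The delicate point is the boundary term of Green's identity at \<open>b\<close>. Its
  vanishing has different reasons in the limit point and the limit circle case; self-adjointness of
  the full operator supplies it in both at once. A cutoff is unavoidable because \<open>u_+\<close>
  is controlled near \<open>b\<close> only, while elements of the graph of \<open>H\<close> must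
  behave well at both ends.

  No resolvent of a half-line operator enters: analyticity of \<open>m_+\<close> is extracted from
  Green's identity by pairing Weyl solutions for different spectral parameters. As
  \<open>weyl_m\<close> is a definite description, existence and uniqueness must be settled before
  anything else can be said about it. As limit circle refers to a single spectral parameter, its
  independence of that parameter has to be proved.

  Absolute continuity means being an indefinite integral, so the calculus of Wronskians is built on
  integrals and never differentiates almost everywhere.\<close>

lemma einterval_Icc_subset:
  "x \<in> einterval a b \<Longrightarrow> y \<in> einterval a b \<Longrightarrow> {x..y} \<subseteq> einterval a b"
  by (auto simp: einterval_iff) (metis ereal_less_eq(3) less_le_trans, metis ereal_less_eq(3) le_less_trans)

text \<open>Telescoping along a fine uniform partition carries the bound from short increments to
  the whole interval, and \<open>e\<close> is arbitrary. A derivative that vanishes only almost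
  everywhere would not force constancy; the comparison with increments of \<open>\<Phi>\<close>
  does.\<close>

lemma const_if_small_increments:
  fixes P :: "real \<Rightarrow> complex" and \<Phi> :: "real \<Rightarrow> real"
  assumes "X \<le> Y"
    and small: "\<And>e. e > 0 \<Longrightarrow> \<exists>d>0. \<forall>x\<in>{X..Y}. \<forall>y\<in>{X..Y}. x \<le> y \<longrightarrow> y - x < d \<longrightarrow>
        cmod (P y - P x) \<le> e * (\<Phi> y - \<Phi> x)"
  shows "P Y = P X"
proof -
  have "cmod (P Y - P X) \<le> e * (\<Phi> Y - \<Phi> X)" if e: "e > 0" for e
  proof -
    obtain d where d: "d > 0" and dd: "\<And>x y. \<lbrakk>x \<in> {X..Y}; y \<in> {X..Y}; x \<le> y; y - x < d\<rbrakk> \<Longrightarrow>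
        cmod (P y - P x) \<le> e * (\<Phi> y - \<Phi> x)"
      using small[OF e] by meson
    obtain N :: nat where N: "(Y - X) / d < real N" using reals_Archimedean2 by blast
    have N0: "N > 0" using N d \<open>X \<le> Y\<close>
      by (metis divide_nonneg_pos diff_ge_0_iff_ge gr_zeroI leD of_nat_0)
    define p where "p i = X + real i * ((Y - X) / real N)" for i
    have step: "p (Suc i) - p i = (Y - X) / real N" for i
      by (simp add: p_def distrib_right add_divide_distrib)
    have p0: "p 0 = X" and pN: "p N = Y" using N0 by (auto simp: p_def)
    have pin: "p i \<in> {X..Y}" if "i \<le> N" for i
    proof -
      have "real i * (Y - X) \<le> real N * (Y - X)"
        using that \<open>X \<le> Y\<close> by (intro mult_right_mono) auto
      then have "real i * (Y - X) / real N \<le> Y - X"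
        using N0 by (simp add: pos_divide_le_eq mult.commute)
      moreover have "0 \<le> real i * (Y - X) / real N" using \<open>X \<le> Y\<close> by simp
      ultimately show ?thesis by (simp add: p_def)
    qed
    have small': "(Y - X) / real N < d" using N N0 d by (simp add: field_simps)
    have "cmod (P (p i) - P X) \<le> e * (\<Phi> (p i) - \<Phi> X)" if "i \<le> N" for i
      using that
    proof (induction i)
      case 0
      then show ?case by (simp add: p0)
    next
      case (Suc i)
      have "cmod (P (p (Suc i)) - P (p i)) \<le> e * (\<Phi> (p (Suc i)) - \<Phi> (p i))"
        using Suc.prems pin[of i] pin[of "Suc i"] small' step[of i] \<open>X \<le> Y\<close>
        by (intro dd) (auto simp: algebra_simps zero_le_divide_iff)
      moreover have "cmod (P (p (Suc i)) - P X) \<le> cmod (P (p (Suc i)) - P (p i)) + cmod (P (p i) - P X)"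
        by (rule order_trans[OF _ norm_triangle_ineq]) simp
      ultimately show ?case using Suc by (simp add: algebra_simps)
    qed
    from this[of N] pN show ?thesis by simp
  qed
  note * = this
  have "cmod (P Y - P X) \<le> 0"
  proof (rule field_le_epsilon)
    fix e :: real assume "e > 0"
    \<comment> \<open>The summand 1 keeps \<open>K\<close> positive when \<open>\<Phi>\<close> takes
      the same value at both ends.\<close>
    define K where "K = \<bar>\<Phi> Y - \<Phi> X\<bar> + 1"
    have "cmod (P Y - P X) \<le> (e / K) * (\<Phi> Y - \<Phi> X)"
      using \<open>e > 0\<close> by (intro *) (auto simp: K_def intro!: divide_pos_pos)
    also have "\<dots> \<le> (e / K) * K"
      using \<open>e > 0\<close> by (intro mult_left_mono) (auto simp: K_def)
    also have "\<dots> = e" by (auto simp: K_def)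
    finally show "cmod (P Y - P X) \<le> 0 + e" by simp
  qed
  then show ?thesis by simp
qed

lemma has_ac_derivative_continuous_on:
  assumes "has_ac_derivative a b F G"
  shows "continuous_on (einterval a b) F"
proof (rule continuous_at_imp_continuous_on, intro ballI)
  fix x assume x: "x \<in> einterval a b"
  then obtain e where e: "e > 0" "cball x e \<subseteq> einterval a b"
    using open_contains_cball[of "einterval a b"] open_einterval by blast
  define X Y where "X = x - e" and "Y = x + e"
  have XY: "X \<in> einterval a b" "Y \<in> einterval a b" "X < x" "x < Y"
    using e by (auto simp: X_def Y_def cball_def dist_real_def subset_iff)
  have int: "G absolutely_integrable_on {X..Y}"
    using assms XY by (auto simp: has_ac_derivative_def loc_integrable_def)
  then have "G integrable_on {X..Y}" using set_lebesgue_integral_eq_integral(1) by blast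
  then have "continuous_on {X..Y} (\<lambda>t. F X + integral {X..t} G)"
    by (intro continuous_intros indefinite_integral_continuous_1)
  moreover have "F X + integral {X..t} G = F t" if "t \<in> {X..Y}" for t
  proof -
    have "t \<in> einterval a b" using that einterval_Icc_subset[OF XY(1,2)] by auto
    then have "F t - F X = integral {X..t} G"
      using assms XY that by (auto simp: has_ac_derivative_def)
    then show ?thesis by (simp add: algebra_simps)
  qed
  ultimately have "continuous_on {X..Y} F"
    by (metis (no_types, lifting) continuous_on_cong)
  then have "continuous_on {X<..<Y} F"
    by (rule continuous_on_subset) auto
  then show "isCont F x"
    using XY by (auto simp: continuous_on_eq_continuous_at)
qed

lemma absolutely_integrable_continuous_mult:
  fixes f g :: "real \<Rightarrow> complex"
  assumes "f absolutely_integrable_on {x..y}" and "continuous_on {x..y} g"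
  shows "(\<lambda>t. g t * f t) absolutely_integrable_on {x..y}"
    and "(\<lambda>t. f t * g t) absolutely_integrable_on {x..y}"
proof -
  show *: "(\<lambda>t. g t * f t) absolutely_integrable_on {x..y}"
  proof (rule absolutely_integrable_bounded_measurable_product[of "(*)"])
    show "g \<in> borel_measurable (lebesgue_on {x..y})"
      using assms by (intro continuous_imp_measurable_on_sets_lebesgue) auto
    show "bounded (g ` {x..y})"
      using assms by (intro compact_imp_bounded compact_continuous_image) auto
  qed (use assms bilinear_times in auto)
  then show "(\<lambda>t. f t * g t) absolutely_integrable_on {x..y}" by (simp add: mult.commute)
qed

text \<open>On a short interval the error of the claimed formula is the integral of
  \<open>f t * (G x - G t) + (F y - F t) * g t\<close>. Uniform continuity of \<open>F\<close> and
  \<open>G\<close> makes it small compared with the integral of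
  \<open>cmod (f t) + cmod (g t)\<close>, so the defect \<open>P\<close> is constant.\<close>

lemma has_ac_derivative_mult:
  assumes F: "has_ac_derivative a b F f" and G: "has_ac_derivative a b G g"
  shows "has_ac_derivative a b (\<lambda>x. F x * G x) (\<lambda>x. f x * G x + F x * g x)"
proof -
  let ?E = "einterval a b"
  have cF: "continuous_on ?E F" and cG: "continuous_on ?E G"
    using assms has_ac_derivative_continuous_on by blast+
  have f: "f absolutely_integrable_on {x..y}" and g: "g absolutely_integrable_on {x..y}"
    if "x \<in> ?E" "y \<in> ?E" for x y
    using F G that by (auto simp: has_ac_derivative_def loc_integrable_def)
  have fi: "f integrable_on {x..y}" and gi: "g integrable_on {x..y}"
    and nfi: "(\<lambda>t. cmod (f t)) integrable_on {x..y}" and ngi: "(\<lambda>t. cmod (g t)) integrable_on {x..y}"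
    if "x \<in> ?E" "y \<in> ?E" for x y
    using f[OF that] g[OF that] by (auto simp: absolutely_integrable_on_def)
  have fG: "(\<lambda>t. f t * G t) absolutely_integrable_on {x..y}"
    and Fg: "(\<lambda>t. F t * g t) absolutely_integrable_on {x..y}" if "x \<in> ?E" "y \<in> ?E" for x y
    using absolutely_integrable_continuous_mult(2)[OF f[OF that] continuous_on_subset[OF cG]]
      absolutely_integrable_continuous_mult(1)[OF g[OF that] continuous_on_subset[OF cF]]
      einterval_Icc_subset[OF that] by auto
  have int: "(\<lambda>t. f t * G t + F t * g t) absolutely_integrable_on {x..y}" if "x \<in> ?E" "y \<in> ?E" for x y
    using fG[OF that] Fg[OF that] by (rule set_integral_add)
  have inti: "(\<lambda>t. f t * G t + F t * g t) integrable_on {x..y}" if "x \<in> ?E" "y \<in> ?E" for x y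
    using int[OF that] by (auto simp: absolutely_integrable_on_def)
  have dF: "F y - F x = integral {x..y} f" and dG: "G y - G x = integral {x..y} g"
    if "x \<in> ?E" "y \<in> ?E" "x \<le> y" for x y
    using F G that by (auto simp: has_ac_derivative_def)
  have "F Y * G Y - F X * G X = integral {X..Y} (\<lambda>t. f t * G t + F t * g t)"
    if XY: "X \<in> ?E" "Y \<in> ?E" "X \<le> Y" for X Y
  proof -
    define P where "P x = F x * G x - integral {X..x} (\<lambda>t. f t * G t + F t * g t)" for x
    define \<Phi> where "\<Phi> x = integral {X..x} (\<lambda>t. cmod (f t) + cmod (g t))" for x
    note sub = einterval_Icc_subset[OF XY(1,2)]
    have uF: "uniformly_continuous_on {X..Y} F" and uG: "uniformly_continuous_on {X..Y} G"
      using cF cG sub by (auto intro!: compact_uniformly_continuous intro: continuous_on_subset)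
    have "P Y = P X"
    proof (rule const_if_small_increments[OF XY(3), where \<Phi> = \<Phi>])
      fix e :: real assume "e > 0"
      obtain d1 where d1: "d1 > 0" "\<And>x y. \<lbrakk>x \<in> {X..Y}; y \<in> {X..Y}; dist y x < d1\<rbrakk> \<Longrightarrow> dist (F y) (F x) < e"
        using uF \<open>e > 0\<close> unfolding uniformly_continuous_on_def by meson
      obtain d2 where d2: "d2 > 0" "\<And>x y. \<lbrakk>x \<in> {X..Y}; y \<in> {X..Y}; dist y x < d2\<rbrakk> \<Longrightarrow> dist (G y) (G x) < e"
        using uG \<open>e > 0\<close> unfolding uniformly_continuous_on_def by meson
      have "cmod (P y - P x) \<le> e * (\<Phi> y - \<Phi> x)"
        if xy: "x \<in> {X..Y}" "y \<in> {X..Y}" "x \<le> y" "y - x < min d1 d2" for x y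
      proof -
        have E: "x \<in> ?E" "y \<in> ?E" using xy sub by auto
        have sp1: "integral {X..y} (\<lambda>t. f t * G t + F t * g t) =
            integral {X..x} (\<lambda>t. f t * G t + F t * g t) + integral {x..y} (\<lambda>t. f t * G t + F t * g t)"
          using inti[OF XY(1) E(2)] xy by (intro Henstock_Kurzweil_Integration.integral_combine[symmetric]) auto
        have "(\<lambda>t. cmod (f t) + cmod (g t)) integrable_on {X..y}"
          using nfi[OF XY(1) E(2)] ngi[OF XY(1) E(2)] by (rule integrable_add)
        then have sp2: "\<Phi> y - \<Phi> x = integral {x..y} (\<lambda>t. cmod (f t) + cmod (g t))"
          unfolding \<Phi>_def
          using xy by (subst Henstock_Kurzweil_Integration.integral_combine[symmetric, of X x y]) auto
        have i1: "(\<lambda>t. f t * G x) integrable_on {x..y}" "(\<lambda>t. F y * g t) integrable_on {x..y}"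
          using fi[OF E] gi[OF E] by (auto intro: integrable_on_mult_left integrable_on_mult_right)
        \<comment> \<open>Discrete product rule: with \<open>G\<close> taken at the left end and
          \<open>F\<close> at the right end there is no remainder.\<close>
        have "P y - P x = integral {x..y} f * G x + F y * integral {x..y} g
            - integral {x..y} (\<lambda>t. f t * G t + F t * g t)"
          unfolding P_def sp1 dF[OF E xy(3), symmetric] dG[OF E xy(3), symmetric]
          by (simp add: algebra_simps)
        also have "\<dots> = integral {x..y} (\<lambda>t. f t * G x + F y * g t)
            - integral {x..y} (\<lambda>t. f t * G t + F t * g t)"
          using i1 by (subst Henstock_Kurzweil_Integration.integral_add) auto
        also have "\<dots> = integral {x..y} (\<lambda>t. (f t * G x + F y * g t) - (f t * G t + F t * g t))"
          using i1 inti[OF E] by (intro Henstock_Kurzweil_Integration.integral_diff[symmetric]) (auto intro: integrable_add)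
        also have "cmod \<dots> \<le> integral {x..y} (\<lambda>t. e * (cmod (f t) + cmod (g t)))"
        proof (rule integral_norm_bound_integral)
          show "(\<lambda>t. f t * G x + F y * g t - (f t * G t + F t * g t)) integrable_on {x..y}"
            using i1 inti[OF E] by (intro integrable_diff) (auto intro: integrable_add)
          show "(\<lambda>t. e * (cmod (f t) + cmod (g t))) integrable_on {x..y}"
            using nfi[OF E] ngi[OF E] by (intro integrable_on_mult_right integrable_add) auto
          fix t assume t: "t \<in> {x..y}"
          have "dist (F y) (F t) < e" using t xy by (intro d1) (auto simp: dist_real_def)
          moreover have "dist (G x) (G t) < e" using t xy by (intro d2) (auto simp: dist_real_def)
          ultimately have le: "cmod (F y - F t) \<le> e" "cmod (G x - G t) \<le> e" by (auto simp: dist_norm)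
          have "f t * G x + F y * g t - (f t * G t + F t * g t) = f t * (G x - G t) + (F y - F t) * g t"
            by (simp add: algebra_simps)
          also have "cmod \<dots> \<le> cmod (f t) * cmod (G x - G t) + cmod (F y - F t) * cmod (g t)"
            using norm_triangle_ineq[of "f t * (G x - G t)" "(F y - F t) * g t"] by (simp only: norm_mult)
          also have "\<dots> \<le> cmod (f t) * e + e * cmod (g t)"
            using le by (intro add_mono mult_left_mono mult_right_mono) auto
          finally show "cmod (f t * G x + F y * g t - (f t * G t + F t * g t)) \<le> e * (cmod (f t) + cmod (g t))"
            by (simp add: algebra_simps)
        qed
        also have "\<dots> = e * (\<Phi> y - \<Phi> x)"
          unfolding sp2 by simp
        finally show ?thesis .
      qed
      then show "\<exists>d>0. \<forall>x\<in>{X..Y}. \<forall>y\<in>{X..Y}. x \<le> y \<longrightarrow> y - x < d \<longrightarrow>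
          cmod (P y - P x) \<le> e * (\<Phi> y - \<Phi> x)"
        using d1(1) d2(1) by (intro exI[of _ "min d1 d2"]) auto
    qed
    then show ?thesis by (simp add: P_def algebra_simps)
  qed
  then show ?thesis using int by (auto simp: has_ac_derivative_def loc_integrable_def)
qed

section \<open>The differential expression\<close>

lemma has_ac_derivative_cong:
  assumes "\<And>x. x \<in> einterval a b \<Longrightarrow> F x = F' x" and "\<And>x. x \<in> einterval a b \<Longrightarrow> G x = G' x"
  shows "has_ac_derivative a b F G \<longleftrightarrow> has_ac_derivative a b F' G'"
proof -
  have *: "x \<in> einterval a b \<Longrightarrow> y \<in> einterval a b \<Longrightarrow> t \<in> {x..y} \<Longrightarrow> G t = G' t" for x y t
    using assms einterval_Icc_subset by blast
  have "x \<in> einterval a b \<Longrightarrow> y \<in> einterval a b \<Longrightarrow>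
      (G absolutely_integrable_on {x..y}) = (G' absolutely_integrable_on {x..y})" for x y
    using * by (intro set_integrable_cong) auto
  moreover have "x \<in> einterval a b \<Longrightarrow> y \<in> einterval a b \<Longrightarrow> integral {x..y} G = integral {x..y} G'" for x y
    using * by (intro Henstock_Kurzweil_Integration.integral_cong) auto
  ultimately show ?thesis using assms(1)
    by (simp add: has_ac_derivative_def loc_integrable_def)
qed

lemma has_ac_derivative_C1:
  assumes "\<And>x. x \<in> einterval a b \<Longrightarrow> (F has_vector_derivative G x) (at x)"
    and "continuous_on (einterval a b) G"
  shows "has_ac_derivative a b F G"
  unfolding has_ac_derivative_def loc_integrable_def
proof (intro conjI ballI impI)
  fix x y assume xy: "x \<in> einterval a b" "y \<in> einterval a b"
  note sub = einterval_Icc_subset[OF xy]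
  show "G absolutely_integrable_on {x..y}"
    using assms(2) sub by (intro absolutely_integrable_continuous_real) (rule continuous_on_subset)
  show "F y - F x = integral {x..y} G" if "x \<le> y"
  proof -
    have "(G has_integral F y - F x) {x..y}"
    proof (rule fundamental_theorem_of_calculus[OF that])
      fix t assume "t \<in> {x..y}"
      with sub have "t \<in> einterval a b" by blast
      then show "(F has_vector_derivative G t) (at t within {x..y})"
        by (rule has_vector_derivative_at_within[OF assms(1)])
    qed
    then show ?thesis by (simp add: integral_unique)
  qed
qed

lemma has_ac_derivative_add:
  assumes "has_ac_derivative a b F f" and "has_ac_derivative a b G g"
  shows "has_ac_derivative a b (\<lambda>x. F x + G x) (\<lambda>x. f x + g x)"
  unfolding has_ac_derivative_def loc_integrable_def
proof (intro conjI ballI impI)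
  fix x y assume xy: "x \<in> einterval a b" "y \<in> einterval a b"
  have fg: "f absolutely_integrable_on {x..y}" "g absolutely_integrable_on {x..y}"
    using assms xy by (auto simp: has_ac_derivative_def loc_integrable_def)
  then show "(\<lambda>x. f x + g x) absolutely_integrable_on {x..y}" by (rule set_integral_add)
  assume "x \<le> y"
  then have "F y - F x = integral {x..y} f" "G y - G x = integral {x..y} g"
    using assms xy unfolding has_ac_derivative_def by blast+
  moreover have "integral {x..y} (\<lambda>x. f x + g x) = integral {x..y} f + integral {x..y} g"
    using fg by (intro Henstock_Kurzweil_Integration.integral_add set_lebesgue_integral_eq_integral(1))
  ultimately show "F y + G y - (F x + G x) = integral {x..y} (\<lambda>x. f x + g x)"
    by (simp add: algebra_simps)
qed

lemma has_ac_derivative_linear: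
  assumes "has_ac_derivative a b F f" and h: "bounded_linear h"
  shows "has_ac_derivative a b (\<lambda>x. h (F x)) (\<lambda>x. h (f x))"
  unfolding has_ac_derivative_def loc_integrable_def
proof (intro conjI ballI impI)
  fix x y assume xy: "x \<in> einterval a b" "y \<in> einterval a b"
  have f: "f absolutely_integrable_on {x..y}"
    using assms xy by (auto simp: has_ac_derivative_def loc_integrable_def)
  show "(\<lambda>x. h (f x)) absolutely_integrable_on {x..y}"
    using absolutely_integrable_linear[OF f h] by (simp add: o_def)
  assume "x \<le> y"
  then have "h (F y) - h (F x) = h (integral {x..y} f)"
    using assms xy linear_diff[OF bounded_linear.linear[OF h], of "F y" "F x"]
    by (simp add: has_ac_derivative_def)
  also have "\<dots> = integral {x..y} (h \<circ> f)"
    using set_lebesgue_integral_eq_integral(1)[OF f] h by (rule integral_linear[symmetric])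
  finally show "h (F y) - h (F x) = integral {x..y} (\<lambda>x. h (f x))" by (simp add: o_def)
qed

lemma tau_eq_derivative:
  "tau_eq a b q u g \<Longrightarrow> x \<in> einterval a b \<Longrightarrow> (u has_vector_derivative vderiv u x) (at x)"
  by (auto simp: tau_eq_def vector_derivative_works)

lemma tau_eq_continuous:
  assumes "tau_eq a b q u g"
  shows "continuous_on (einterval a b) u" and "continuous_on (einterval a b) (vderiv u)"
proof -
  show "continuous_on (einterval a b) u"
    using tau_eq_derivative[OF assms]
    by (intro continuous_at_imp_continuous_on ballI) (metis has_vector_derivative_continuous)
  show "continuous_on (einterval a b) (vderiv u)"
    using assms by (auto simp: tau_eq_def intro: has_ac_derivative_continuous_on)
qed

lemma tau_eq_has_ac_derivative:
  assumes "tau_eq a b q u g"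
  shows "has_ac_derivative a b u (vderiv u)"
    and "has_ac_derivative a b (vderiv u) (\<lambda>x. complex_of_real (q x) * u x - g x)"
  using tau_eq_continuous[OF assms] tau_eq_derivative[OF assms] assms
  by (auto simp: tau_eq_def intro: has_ac_derivative_C1)

lemma tau_eqI:
  assumes u: "\<And>x. x \<in> einterval a b \<Longrightarrow> (u has_vector_derivative u' x) (at x)"
    and u': "has_ac_derivative a b u' (\<lambda>x. complex_of_real (q x) * u x - g x)"
  shows "tau_eq a b q u g"
proof -
  have "vderiv u x = u' x" if "x \<in> einterval a b" for x
    using u[OF that] by (rule vector_derivative_at)
  then have "has_ac_derivative a b (vderiv u) (\<lambda>x. complex_of_real (q x) * u x - g x)"
    using u' by (subst has_ac_derivative_cong) auto
  then show ?thesis using u by (auto simp: tau_eq_def intro: differentiableI_vector)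
qed

lemma tau_eq_cnj:
  assumes "tau_eq a b q u g"
  shows "tau_eq a b q (\<lambda>x. cnj (u x)) (\<lambda>x. cnj (g x))"
proof (rule tau_eqI)
  show "((\<lambda>x. cnj (u x)) has_vector_derivative cnj (vderiv u x)) (at x)" if "x \<in> einterval a b" for x
    using tau_eq_derivative[OF assms that] by (rule has_vector_derivative_cnj)
  show "has_ac_derivative a b (\<lambda>x. cnj (vderiv u x)) (\<lambda>x. complex_of_real (q x) * cnj (u x) - cnj (g x))"
    using has_ac_derivative_linear[OF tau_eq_has_ac_derivative(2)[OF assms] bounded_linear_cnj] by simp
qed

lemma tau_eq_lincomb:
  assumes u: "tau_eq a b q u g" and v: "tau_eq a b q v h"
  shows "tau_eq a b q (\<lambda>x. \<alpha> * u x + \<beta> * v x) (\<lambda>x. \<alpha> * g x + \<beta> * h x)"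
proof (rule tau_eqI)
  show "((\<lambda>x. \<alpha> * u x + \<beta> * v x) has_vector_derivative \<alpha> * vderiv u x + \<beta> * vderiv v x) (at x)"
    if "x \<in> einterval a b" for x
    using tau_eq_derivative[OF u that] tau_eq_derivative[OF v that]
    by (auto intro!: derivative_eq_intros)
  have "has_ac_derivative a b (\<lambda>x. \<alpha> * vderiv u x + \<beta> * vderiv v x)
      (\<lambda>x. \<alpha> * (complex_of_real (q x) * u x - g x) + \<beta> * (complex_of_real (q x) * v x - h x))"
    by (intro has_ac_derivative_add has_ac_derivative_linear[OF tau_eq_has_ac_derivative(2)[OF u]]
        has_ac_derivative_linear[OF tau_eq_has_ac_derivative(2)[OF v]] bounded_linear_mult_right)
  then show "has_ac_derivative a b (\<lambda>x. \<alpha> * vderiv u x + \<beta> * vderiv v x)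
      (\<lambda>x. complex_of_real (q x) * (\<alpha> * u x + \<beta> * v x) - (\<alpha> * g x + \<beta> * h x))"
    by (simp add: algebra_simps)
qed

text \<open>The terms with \<open>\<eta>'\<close> and \<open>\<eta>''\<close> are continuous and
  live only where the cutoff varies. Hence they cannot spoil square integrability near the
  endpoints.\<close>

lemma tau_eq_cutoff:
  fixes \<eta> \<eta>' \<eta>'' :: "real \<Rightarrow> real" and u g :: "real \<Rightarrow> complex"
  assumes u: "tau_eq a b q u g"
    and \<eta>: "\<And>x. (\<eta> has_real_derivative \<eta>' x) (at x)"
    and \<eta>': "\<And>x. (\<eta>' has_real_derivative \<eta>'' x) (at x)"
    and \<eta>'': "continuous_on UNIV \<eta>''"
  shows "tau_eq a b q (\<lambda>x. complex_of_real (\<eta> x) * u x)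
    (\<lambda>x. complex_of_real (\<eta> x) * g x - 2 * complex_of_real (\<eta>' x) * vderiv u x - complex_of_real (\<eta>'' x) * u x)"
proof (rule tau_eqI)
  show "((\<lambda>x. complex_of_real (\<eta> x) * u x) has_vector_derivative
      complex_of_real (\<eta>' x) * u x + complex_of_real (\<eta> x) * vderiv u x) (at x)"
    if "x \<in> einterval a b" for x
    using has_vector_derivative_mult[OF has_vector_derivative_of_real[OF \<eta>[of x]] tau_eq_derivative[OF u that]]
    by (simp add: add.commute)
  have c\<eta>': "continuous_on UNIV \<eta>'"
    by (intro continuous_at_imp_continuous_on ballI DERIV_isCont[OF \<eta>'])
  have 1: "has_ac_derivative a b (\<lambda>x. complex_of_real (\<eta> x)) (\<lambda>x. complex_of_real (\<eta>' x))"
    by (intro has_ac_derivative_C1 has_vector_derivative_of_real continuous_on_of_real \<eta>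
        continuous_on_subset[OF c\<eta>'] subset_UNIV)
  have 2: "has_ac_derivative a b (\<lambda>x. complex_of_real (\<eta>' x)) (\<lambda>x. complex_of_real (\<eta>'' x))"
    by (intro has_ac_derivative_C1 has_vector_derivative_of_real continuous_on_of_real \<eta>'
        continuous_on_subset[OF \<eta>''] subset_UNIV)
  show "has_ac_derivative a b (\<lambda>x. complex_of_real (\<eta>' x) * u x + complex_of_real (\<eta> x) * vderiv u x)
     (\<lambda>x. complex_of_real (q x) * (complex_of_real (\<eta> x) * u x) -
       (complex_of_real (\<eta> x) * g x - 2 * complex_of_real (\<eta>' x) * vderiv u x - complex_of_real (\<eta>'' x) * u x))"
    using has_ac_derivative_add[OF has_ac_derivative_mult[OF 2 tau_eq_has_ac_derivative(1)[OF u]]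
        has_ac_derivative_mult[OF 1 tau_eq_has_ac_derivative(2)[OF u]]]
    by (rule has_ac_derivative_cong[THEN iffD1, rotated -1]) (simp_all add: algebra_simps)
qed

text \<open>The product rule produces the product of the two derivatives and the term with
  \<open>q\<close> twice, with opposite signs, so the potential drops out.\<close>

lemma lagrange:
  assumes u: "tau_eq a b q u g" and v: "tau_eq a b q v h"
  shows "has_ac_derivative a b (wronskian u v) (\<lambda>x. g x * v x - u x * h x)"
proof -
  have "has_ac_derivative a b (\<lambda>x. u x * vderiv v x + (- 1) * (vderiv u x * v x))
    (\<lambda>x. (vderiv u x * vderiv v x + u x * (complex_of_real (q x) * v x - h x)) +
      (- 1) * ((complex_of_real (q x) * u x - g x) * v x + vderiv u x * vderiv v x))"
    using tau_eq_has_ac_derivative[OF u] tau_eq_has_ac_derivative[OF v]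
    by (intro has_ac_derivative_add has_ac_derivative_mult has_ac_derivative_linear[OF _ bounded_linear_mult_right])
  then show ?thesis
    by (rule has_ac_derivative_cong[THEN iffD1, rotated -1]) (simp_all add: wronskian_def algebra_simps)
qed

lemma lagrange_integral:
  assumes "tau_eq a b q u g" and "tau_eq a b q v h"
    and "x \<in> einterval a b" "y \<in> einterval a b" "x \<le> y"
  shows "integral {x..y} (\<lambda>t. g t * v t - u t * h t) = wronskian u v y - wronskian u v x"
  using lagrange[OF assms(1,2)] assms(3-) by (simp add: has_ac_derivative_def)

lemma wronskian_solutions_const:
  assumes u: "solution a b q z u" and v: "solution a b q z v"
    and xy: "x \<in> einterval a b" "y \<in> einterval a b"
  shows "wronskian u v x = wronskian u v y"
proof -
  have *: "wronskian u v y - wronskian u v x = 0"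
    if "x \<in> einterval a b" "y \<in> einterval a b" "x \<le> y" for x y
    using lagrange_integral[of a b q u _ v, OF u[unfolded solution_def] v[unfolded solution_def] that]
    by (simp add: algebra_simps)
  show ?thesis using *[OF xy] *[OF xy(2,1)] by (cases "x \<le> y") auto
qed

section \<open>Square integrable functions\<close>

lemma einterval_lebesgue [simp]: "einterval a b \<in> sets lebesgue"
  by (simp add: lborelD)

lemma einterval_right_subset: "c \<in> einterval a b \<Longrightarrow> einterval (ereal c) b \<subseteq> einterval a b"
  unfolding einterval_def by (blast intro: less_trans)

lemma integrable_lebesgue_on_iff:
  fixes f :: "real \<Rightarrow> 'a::euclidean_space"
  shows "S \<in> sets lebesgue \<Longrightarrow> integrable (lebesgue_on S) f \<longleftrightarrow> f absolutely_integrable_on S"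
  by (simp add: integrable_restrict_space set_integrable_def)

lemma L2_iff:
  "f \<in> L2 a b \<longleftrightarrow> f \<in> borel_measurable (lebesgue_on (einterval a b)) \<and>
    (\<lambda>x. (cmod (f x))\<^sup>2) absolutely_integrable_on einterval a b"
  by (simp add: L2_def integrable_lebesgue_on_iff)

lemma L2_continuous_iff:
  assumes "continuous_on (einterval a b) f"
  shows "f \<in> L2 a b \<longleftrightarrow> (\<lambda>x. (cmod (f x))\<^sup>2) absolutely_integrable_on einterval a b"
  using assms by (simp add: L2_iff continuous_imp_measurable_on_sets_lebesgue)

lemma L2_mult:
  assumes "f \<in> L2 a b" and "g \<in> L2 a b"
  shows "(\<lambda>x. f x * g x) absolutely_integrable_on einterval a b"
proof (rule measurable_bounded_by_integrable_imp_absolutely_integrable)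
  have [measurable]: "f \<in> borel_measurable (lebesgue_on (einterval a b))"
    "g \<in> borel_measurable (lebesgue_on (einterval a b))" using assms by (auto simp: L2_iff)
  show "(\<lambda>x. f x * g x) \<in> borel_measurable (lebesgue_on (einterval a b))" by measurable
  show "(\<lambda>x. (cmod (f x))\<^sup>2 + (cmod (g x))\<^sup>2) integrable_on einterval a b"
    using assms by (auto simp: L2_iff intro!: integrable_add set_lebesgue_integral_eq_integral(1))
  fix x
  show "cmod (f x * g x) \<le> (cmod (f x))\<^sup>2 + (cmod (g x))\<^sup>2"
    using sum_squares_bound[of "cmod (f x)" "cmod (g x)"]
      mult_nonneg_nonneg[OF norm_ge_zero norm_ge_zero, of "f x" "g x"]
    unfolding norm_mult by linarith
qed auto

lemma L2_cnj: "f \<in> L2 a b \<Longrightarrow> (\<lambda>x. cnj (f x)) \<in> L2 a b"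
  by (auto simp: L2_iff intro: borel_measurable_continuous_on[OF continuous_on_cnj[OF continuous_on_id]])

lemma cmod_add_square_le: "(cmod (x + y))\<^sup>2 \<le> 2 * (cmod x)\<^sup>2 + 2 * (cmod y)\<^sup>2"
proof -
  have "(cmod (x + y))\<^sup>2 \<le> (cmod x + cmod y)\<^sup>2"
    by (intro power_mono norm_triangle_ineq) auto
  also have "\<dots> \<le> 2 * (cmod x)\<^sup>2 + 2 * (cmod y)\<^sup>2"
    using sum_squares_bound[of "cmod x" "cmod y"] by (simp add: power2_sum)
  finally show ?thesis .
qed

lemma L2_lincomb:
  assumes "f \<in> L2 a b" and "g \<in> L2 a b"
  shows "(\<lambda>x. \<alpha> * f x + \<beta> * g x) \<in> L2 a b"
proof -
  have [measurable]: "f \<in> borel_measurable (lebesgue_on (einterval a b))"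
    "g \<in> borel_measurable (lebesgue_on (einterval a b))" using assms by (auto simp: L2_iff)
  have m: "(\<lambda>x. \<alpha> * f x + \<beta> * g x) \<in> borel_measurable (lebesgue_on (einterval a b))" by measurable
  have "(\<lambda>x. (cmod (\<alpha> * f x + \<beta> * g x))\<^sup>2) absolutely_integrable_on einterval a b"
  proof (rule measurable_bounded_by_integrable_imp_absolutely_integrable)
    show "(\<lambda>x. (cmod (\<alpha> * f x + \<beta> * g x))\<^sup>2) \<in> borel_measurable (lebesgue_on (einterval a b))" by measurable
    show "(\<lambda>x. 2 * (cmod \<alpha>)\<^sup>2 * (cmod (f x))\<^sup>2 + 2 * (cmod \<beta>)\<^sup>2 * (cmod (g x))\<^sup>2) integrable_on einterval a b"
      using assms
      by (auto simp: L2_iff intro!: integrable_add integrable_on_mult_right set_lebesgue_integral_eq_integral(1))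
    show "norm ((cmod (\<alpha> * f x + \<beta> * g x))\<^sup>2) \<le> 2 * (cmod \<alpha>)\<^sup>2 * (cmod (f x))\<^sup>2 + 2 * (cmod \<beta>)\<^sup>2 * (cmod (g x))\<^sup>2" for x
      using cmod_add_square_le[of "\<alpha> * f x" "\<beta> * g x"] by (simp add: norm_mult power_mult_distrib)
  qed auto
  then show ?thesis using m by (simp add: L2_iff)
qed

lemma L2_cmult: "f \<in> L2 a b \<Longrightarrow> (\<lambda>x. \<alpha> * f x) \<in> L2 a b"
  using L2_lincomb[of f a b f \<alpha> 0] by simp

lemma L2_subset:
  assumes "f \<in> L2 a b" and "einterval c d \<subseteq> einterval a b"
  shows "f \<in> L2 c d"
  using assms by (auto simp: L2_iff intro: measurable_restrict_mono set_integrable_subset)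

lemma L2_inner_eq: "f \<in> L2 a b \<Longrightarrow> g \<in> L2 a b \<Longrightarrow>
    L2_inner a b f g = integral (einterval a b) (\<lambda>x. cnj (f x) * g x)"
  unfolding L2_inner_def
  by (intro lebesgue_integral_eq_integral) (simp_all add: integrable_lebesgue_on_iff L2_mult L2_cnj)

text \<open>The discriminant criterion: evaluate at the vertex \<open>I / A\<close>. The degenerate
  case \<open>A = 0\<close> has no vertex and forces \<open>I = 0\<close>.\<close>

lemma square_le_if_quadratic_nonneg:
  fixes A B I :: real
  assumes "\<And>t. 0 \<le> A * t\<^sup>2 - 2 * I * t + B" and "A \<ge> 0"
  shows "I\<^sup>2 \<le> A * B"
proof (cases "A = 0")
  case True
  have "I = 0"
  proof (rule ccontr)
    assume "I \<noteq> 0"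
    \<comment> \<open>At this \<open>t\<close> the expression equals -1 when
      \<open>A = 0\<close>.\<close>
    then show False using assms(1)[of "(B + 1) / (2 * I)"] True by simp
  qed
  then show ?thesis using True by simp
next
  case False
  then have "A > 0" using assms by simp
  then show ?thesis using assms(1)[of "I / A"] by (simp add: field_simps power2_eq_square)
qed

lemma L2_Cauchy_Schwarz:
  assumes f: "f \<in> L2 a b" and g: "g \<in> L2 a b"
  defines "E \<equiv> einterval a b"
  shows "(cmod (integral E (\<lambda>x. f x * g x)))\<^sup>2 \<le>
    integral E (\<lambda>x. (cmod (f x))\<^sup>2) * integral E (\<lambda>x. (cmod (g x))\<^sup>2)"
proof -
  define A where "A = integral E (\<lambda>x. (cmod (f x))\<^sup>2)"
  define B where "B = integral E (\<lambda>x. (cmod (g x))\<^sup>2)"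
  define I where "I = integral E (\<lambda>x. cmod (f x) * cmod (g x))"
  have ab: "(\<lambda>x. f x * g x) absolutely_integrable_on E" unfolding E_def using f g by (rule L2_mult)
  then have i: "(\<lambda>x. f x * g x) integrable_on E" "(\<lambda>x. cmod (f x) * cmod (g x)) integrable_on E"
    by (auto simp: absolutely_integrable_on_def norm_mult)
  have ia: "(\<lambda>x. (cmod (f x))\<^sup>2) integrable_on E" "(\<lambda>x. (cmod (g x))\<^sup>2) integrable_on E"
    using f g by (auto simp: L2_iff E_def set_lebesgue_integral_eq_integral(1))
  have "cmod (integral E (\<lambda>x. f x * g x)) \<le> I"
    unfolding I_def by (rule integral_norm_bound_integral[OF i]) (simp add: norm_mult)
  then have "(cmod (integral E (\<lambda>x. f x * g x)))\<^sup>2 \<le> I\<^sup>2" by (intro power_mono) auto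
  also have "I\<^sup>2 \<le> A * B"
  proof (rule square_le_if_quadratic_nonneg)
    show "A \<ge> 0" unfolding A_def by (intro Henstock_Kurzweil_Integration.integral_nonneg ia) auto
    fix t :: real
    have "0 \<le> integral E (\<lambda>x. t\<^sup>2 * (cmod (f x))\<^sup>2 + (- 2 * t) * (cmod (f x) * cmod (g x)) + (cmod (g x))\<^sup>2)"
    proof (rule Henstock_Kurzweil_Integration.integral_nonneg)
      show "(\<lambda>x. t\<^sup>2 * (cmod (f x))\<^sup>2 + (- 2 * t) * (cmod (f x) * cmod (g x)) + (cmod (g x))\<^sup>2) integrable_on E"
        by (intro integrable_add integrable_on_mult_right i ia)
      fix x
      have "0 \<le> (t * cmod (f x) - cmod (g x))\<^sup>2" by simp
      then show "0 \<le> t\<^sup>2 * (cmod (f x))\<^sup>2 + (- 2 * t) * (cmod (f x) * cmod (g x)) + (cmod (g x))\<^sup>2"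
        by (simp add: power2_eq_square algebra_simps)
    qed
    also have "\<dots> = t\<^sup>2 * A + (- 2 * t) * I + B"
      unfolding A_def B_def I_def
      by (subst Henstock_Kurzweil_Integration.integral_add | intro integrable_add integrable_on_mult_right i ia | simp)+
    finally show "0 \<le> A * t\<^sup>2 - 2 * I * t + B" by (simp add: algebra_simps)
  qed
  finally show ?thesis by (simp add: A_def B_def)
qed

section \<open>Integrability up to an endpoint\<close>

lemma loc_integrable_continuous:
  fixes f :: "real \<Rightarrow> 'a::euclidean_space"
  assumes "continuous_on (einterval a b) f"
  shows "loc_integrable a b f"
  unfolding loc_integrable_def
  by (intro ballI absolutely_integrable_continuous_real continuous_on_subset[OF assms] einterval_Icc_subset)

lemma absolutely_integrable_extend_right:
  fixes h :: "real \<Rightarrow> 'a::euclidean_space"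
  assumes "loc_integrable a b h" and "h absolutely_integrable_on einterval (ereal d) b"
    and "c \<in> einterval a b" "d \<in> einterval a b"
  shows "h absolutely_integrable_on einterval (ereal c) b"
proof -
  have "h absolutely_integrable_on {c..d} \<union> einterval (ereal d) b"
    using assms by (intro set_integrable_Un) (auto simp: loc_integrable_def)
  then show ?thesis by (rule set_integrable_subset) (auto simp: einterval_iff)
qed

text \<open>The order of \<open>c\<close> and \<open>d\<close> is left open: for
  \<open>d < c\<close> the middle interval is empty and the two outer ones overlap.\<close>

lemma absolutely_integrable_einterval_Un:
  fixes h :: "real \<Rightarrow> 'a::euclidean_space"
  assumes "loc_integrable a b h" and "h absolutely_integrable_on einterval a (ereal c)"
    and "h absolutely_integrable_on einterval (ereal d) b"
    and "c \<in> einterval a b" "d \<in> einterval a b"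
  shows "h absolutely_integrable_on einterval a b"
proof -
  have "h absolutely_integrable_on (einterval a (ereal c) \<union> {c..d}) \<union> einterval (ereal d) b"
    using assms by (intro set_integrable_Un) (auto simp: loc_integrable_def)
  then show ?thesis by (rule set_integrable_subset) (auto simp: einterval_iff)
qed

text \<open>Continuity inside \<open>(a,b)\<close> allows the unknown starting point in
  \<open>L2_near_right\<close> to be moved to any prescribed one.\<close>

lemma L2_right:
  assumes "L2_near_right a b u" and "continuous_on (einterval a b) u" and "c \<in> einterval a b"
  shows "u \<in> L2 (ereal c) b"
proof -
  obtain d where d: "d \<in> einterval a b" "u \<in> L2 (ereal d) b"
    using assms(1) by (auto simp: L2_near_right_def)
  have "loc_integrable a b (\<lambda>x. (cmod (u x))\<^sup>2)"
    using assms(2) by (intro loc_integrable_continuous continuous_intros)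
  then have "(\<lambda>x. (cmod (u x))\<^sup>2) absolutely_integrable_on einterval (ereal c) b"
    using d assms(3) by (auto simp: L2_iff intro: absolutely_integrable_extend_right)
  moreover have "continuous_on (einterval (ereal c) b) u"
    using assms(2) einterval_right_subset[OF assms(3)] by (rule continuous_on_subset)
  ultimately show ?thesis by (simp add: L2_continuous_iff)
qed

text \<open>Testing the limit along sequences covers finite and infinite \<open>b\<close> alike and
  reduces it to dominated convergence with majorant \<open>norm (h x)\<close>.\<close>

lemma integral_einterval_tendsto:
  fixes h :: "real \<Rightarrow> 'a::euclidean_space"
  assumes h: "h absolutely_integrable_on einterval (ereal c) b" and cb: "ereal c < b"
  shows "((\<lambda>x. integral {c..real_of_ereal x} h) \<longlongrightarrow> integral (einterval (ereal c) b) h) (at_left b)"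
proof (rule tendsto_at_left_sequentially[OF cb])
  fix S assume S: "\<And>n. S n < b" "\<And>n. ereal c < S n" "S \<longlonglongrightarrow> b"
  define s where "s n = real_of_ereal (S n)" for n
  have s: "S n = ereal (s n)" for n
    using S(1,2)[of n] unfolding s_def by (cases "S n") auto
  let ?E = "einterval (ereal c) b"
  have hi: "h integrable_on ?E" "(\<lambda>x. norm (h x)) integrable_on ?E"
    using h by (auto simp: absolutely_integrable_on_def)
  have eq: "integral {c..s n} h = integral ?E (\<lambda>x. if x \<in> {c..s n} then h x else 0)" for n
  proof -
    have "integral ?E (\<lambda>x. if x \<in> {c..s n} then h x else 0) = integral ({c..s n} \<inter> ?E) h"
      by (rule integral_restrict_Int)
    also have "{c..s n} \<inter> ?E = {c<..s n}" using S(1)[of n] unfolding s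
      by (auto simp: einterval_iff) (metis ereal_less_eq(3) le_less_trans)
    also have "integral {c<..s n} h = integral {c..s n} h"
      by (rule integral_spike_set) (auto intro: negligible_subset[of "{c}"])
    finally show ?thesis ..
  qed
  have lim: "(\<lambda>n. integral ?E (\<lambda>x. if x \<in> {c..s n} then h x else 0)) \<longlonglongrightarrow> integral ?E h"
  proof (rule dominated_convergence(2)[where h = "\<lambda>x. norm (h x)"])
    fix n
    have "h absolutely_integrable_on {c<..s n}"
      using S(1)[of n] unfolding s
      by (intro set_integrable_subset[OF h]) (auto simp: einterval_iff, metis ereal_less_eq(3) le_less_trans)
    then have "(\<lambda>x. if x \<in> {c<..s n} then h x else 0) absolutely_integrable_on UNIV"
      by (subst absolutely_integrable_restrict_UNIV)
    then have "(\<lambda>x. if x \<in> {c<..s n} then h x else 0) integrable_on ?E"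
      by (meson set_integrable_subset set_lebesgue_integral_eq_integral(1) einterval_lebesgue subset_UNIV)
    then show "(\<lambda>x. if x \<in> {c..s n} then h x else 0) integrable_on ?E"
      by (rule integrable_eq) (auto simp: einterval_iff)
  next
    fix x assume x: "x \<in> ?E"
    then have "ereal x < b" by (simp add: einterval_iff)
    then have "eventually (\<lambda>n. ereal x < S n) sequentially" using S(3) by (rule order_tendstoD(1)[rotated])
    then have "eventually (\<lambda>n. (if x \<in> {c..s n} then h x else 0) = h x) sequentially"
      by eventually_elim (use x in \<open>auto simp: s einterval_iff\<close>)
    then show "(\<lambda>n. if x \<in> {c..s n} then h x else 0) \<longlonglongrightarrow> h x"
      by (rule tendsto_eventually)
  qed (use hi in auto)
  show "(\<lambda>n. integral {c..real_of_ereal (S n)} h) \<longlonglongrightarrow> integral ?E h"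
    using lim by (simp only: eq[symmetric] s_def[symmetric])
qed

text \<open>Monotone convergence along an exhaustion. Square integrability near \<open>b\<close> is
  obtained this way both from Weyl's discs and in the limit circle case.\<close>

lemma absolutely_integrable_if_bounded:
  fixes h :: "real \<Rightarrow> real"
  assumes "loc_integrable a b h" and c: "c \<in> einterval a b" and pos: "\<And>x. x \<in> einterval a b \<Longrightarrow> 0 \<le> h x"
    and bound: "\<And>d. d \<in> einterval a b \<Longrightarrow> c < d \<Longrightarrow> integral {c..d} h \<le> B"
  shows "h absolutely_integrable_on einterval (ereal c) b"
proof -
  have cb: "ereal c < b" using c by (simp add: einterval_iff)
  let ?E = "einterval (ereal c) b"
  obtain u l :: "nat \<Rightarrow> real" where u: "?E = (\<Union>i. {l i .. u i})" "incseq u" "decseq l"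
    "\<And>i. l i < u i" "\<And>i. ereal c < ereal (l i)" "\<And>i. ereal (u i) < b"
    by (rule einterval_Icc_approximation[OF cb]) blast
  have lu: "c < l i" "c < u i" for i using u(4,5)[of i] by auto
  have uE: "u i \<in> einterval a b" for i
    using einterval_right_subset[OF c] u(6)[of i] lu[of i] by (auto simp: einterval_iff)
  have int: "h absolutely_integrable_on {c..u i}" for i
    using assms(1) c uE by (auto simp: loc_integrable_def)
  have hE: "0 \<le> h x" if "x \<in> ?E" for x
    using that einterval_right_subset[OF c] by (intro pos) blast
  have Ic: "{c<..u i} \<subseteq> ?E" for i
    using u(6)[of i] by (auto simp: einterval_iff) (metis ereal_less_eq(3) le_less_trans)
  have int_eq: "integral ?E (\<lambda>x. if x \<in> {c<..u i} then h x else 0) = integral {c..u i} h" for i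
  proof -
    have "integral ?E (\<lambda>x. if x \<in> {c<..u i} then h x else 0) = integral {c<..u i} h"
      using Ic[of i] by (subst integral_restrict_Int) (simp add: Int_absorb2)
    also have "\<dots> = integral {c..u i} h"
      by (rule integral_spike_set) (auto intro: negligible_subset[of "{c}"])
    finally show ?thesis .
  qed
  have "h integrable_on ?E \<and> (\<lambda>k. integral ?E (\<lambda>x. if x \<in> {c<..u k} then h x else 0)) \<longlonglongrightarrow> integral ?E h"
  proof (rule monotone_convergence_increasing)
    fix i
    have "h absolutely_integrable_on {c<..u i}" by (rule set_integrable_subset[OF int]) auto
    then have "(\<lambda>x. if x \<in> {c<..u i} then h x else 0) absolutely_integrable_on UNIV"
      by (subst absolutely_integrable_restrict_UNIV)
    then show "(\<lambda>x. if x \<in> {c<..u i} then h x else 0) integrable_on ?E"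
      by (meson set_integrable_subset set_lebesgue_integral_eq_integral(1) einterval_lebesgue subset_UNIV)
  next
    fix i x assume "x \<in> ?E"
    then show "(if x \<in> {c<..u i} then h x else 0) \<le> (if x \<in> {c<..u (Suc i)} then h x else 0)"
      using hE[of x] incseq_SucD[OF u(2), of i] by auto
  next
    fix x assume x: "x \<in> ?E"
    then obtain i where "x \<in> {l i..u i}" using u(1) by blast
    then have "x \<in> {c<..u k}" if "k \<ge> i" for k
      using incseqD[OF u(2) that] lu[of i] by auto
    then have "eventually (\<lambda>k. (if x \<in> {c<..u k} then h x else 0) = h x) sequentially"
      unfolding eventually_sequentially by auto
    then show "(\<lambda>k. if x \<in> {c<..u k} then h x else 0) \<longlonglongrightarrow> h x" by (rule tendsto_eventually)
  next
    have "0 \<le> integral {c..u i} h" for i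
      using int[of i] uE einterval_Icc_subset[OF c uE[of i]] pos
      by (intro Henstock_Kurzweil_Integration.integral_nonneg set_lebesgue_integral_eq_integral(1)) auto
    then show "bounded (range (\<lambda>k. integral ?E (\<lambda>x. if x \<in> {c<..u k} then h x else 0)))"
      unfolding int_eq bounded_iff using bound[OF uE lu(2)] by (auto intro!: exI[of _ B])
  qed
  then show ?thesis using hE by (simp add: absolutely_integrable_on_iff_nonneg)
qed

section \<open>Green's identity at the right endpoint\<close>

text \<open>The only critical point is the knot 0. An exponent of at least two makes the difference
  quotient there bounded by a positive power of \<open>max 0 h\<close>.\<close>

lemma DERIV_pos_part_power:
  "((\<lambda>t. max 0 t ^ Suc (Suc n)) has_real_derivative real (Suc (Suc n)) * max 0 t ^ Suc n) (at t)"
proof -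
  consider "t < 0" | "t > 0" | "t = 0" by linarith
  then show ?thesis
  proof cases
    case 1
    have "((\<lambda>t::real. 0) has_real_derivative 0) (at t)" by simp
    then have "((\<lambda>t::real. max 0 t ^ Suc (Suc n)) has_real_derivative 0) (at t)"
      by (rule has_field_derivative_transform_within_open[where S = "{..<0}"]) (use 1 in auto)
    then show ?thesis using 1 by simp
  next
    case 2
    have "((\<lambda>t::real. t ^ Suc (Suc n)) has_real_derivative real (Suc (Suc n)) * t ^ Suc n) (at t)"
      using DERIV_pow[of "Suc (Suc n)" t] by simp
    then have "((\<lambda>t::real. max 0 t ^ Suc (Suc n)) has_real_derivative real (Suc (Suc n)) * t ^ Suc n) (at t)"
      by (rule has_field_derivative_transform_within_open[where S = "{0<..}"]) (use 2 in auto)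
    then show ?thesis using 2 by simp
  next
    case 3
    have "((\<lambda>h::real. max 0 h ^ Suc (Suc n) / h) \<longlongrightarrow> 0) (at 0)"
    proof (rule Lim_null_comparison)
      show "eventually (\<lambda>h::real. norm (max 0 h ^ Suc (Suc n) / h) \<le> max 0 h ^ Suc n) (at 0)"
        by (rule always_eventually) (auto simp: max_def field_simps)
      have "isCont (\<lambda>h::real. max 0 h ^ Suc n) 0" by (intro continuous_intros)
      then show "((\<lambda>h::real. max 0 h ^ Suc n) \<longlongrightarrow> 0) (at 0)"
        by (simp add: isCont_def)
    qed
    then show ?thesis using 3 by (simp add: DERIV_def)
  qed
qed

text \<open>The cutoff is a cubic spline with four equidistant knots.\<close>

lemma ex_C2_cutoff:
  fixes c0 c1 :: real
  assumes "c0 < c1"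
  obtains \<eta> \<eta>' \<eta>'' :: "real \<Rightarrow> real"
  where "\<And>x. (\<eta> has_real_derivative \<eta>' x) (at x)" and "\<And>x. (\<eta>' has_real_derivative \<eta>'' x) (at x)"
    and "continuous_on UNIV \<eta>''"
    and "\<And>x. x \<le> c0 \<Longrightarrow> \<eta> x = 0 \<and> \<eta>' x = 0 \<and> \<eta>'' x = 0"
    and "\<And>x. x \<ge> c1 \<Longrightarrow> \<eta> x = 1 \<and> \<eta>' x = 0 \<and> \<eta>'' x = 0"
proof -
  \<comment> \<open>The rescaling \<open>k * (x - c0)\<close> sends \<open>c0\<close> to the first
    knot 0 and \<open>c1\<close> to the last knot 3.\<close>
  define k where "k = 3 / (c1 - c0)"
  have k: "k > 0" using assms by (simp add: k_def)
  \<comment> \<open>Third difference of a truncated power. Left of all knots it vanishes; right of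
    them it is the third difference of \<open>t ^ n\<close>, which is 0 for \<open>n < 3\<close> and
    6 for \<open>n = 3\<close>. This explains the factor \<open>1/6\<close> below and why both
    derivatives vanish again beyond \<open>c1\<close>.\<close>
  define B where "B n t = max 0 t ^ n - 3 * max 0 (t - 1) ^ n + 3 * max 0 (t - 2) ^ n - max 0 (t - 3) ^ n"
    for n :: nat and t :: real
  have dB: "((\<lambda>t. B (Suc (Suc n)) t) has_real_derivative real (Suc (Suc n)) * B (Suc n) t) (at t)" for n t
  proof -
    have *: "((\<lambda>t. max 0 (t - r) ^ Suc (Suc n)) has_real_derivative real (Suc (Suc n)) * max 0 (t - r) ^ Suc n) (at t)"
      for r :: real
    proof -
      have "((\<lambda>t. t - r) has_real_derivative 1) (at t)" by (auto intro!: derivative_eq_intros)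
      from DERIV_chain2[OF DERIV_pos_part_power this] show ?thesis unfolding mult_1_right .
    qed
    have "((\<lambda>t. max 0 (t - 0) ^ Suc (Suc n) - 3 * max 0 (t - 1) ^ Suc (Suc n) + 3 * max 0 (t - 2) ^ Suc (Suc n)
        - max 0 (t - 3) ^ Suc (Suc n)) has_real_derivative
        real (Suc (Suc n)) * max 0 (t - 0) ^ Suc n - 3 * (real (Suc (Suc n)) * max 0 (t - 1) ^ Suc n)
        + 3 * (real (Suc (Suc n)) * max 0 (t - 2) ^ Suc n) - real (Suc (Suc n)) * max 0 (t - 3) ^ Suc n) (at t)"
      by (intro DERIV_diff DERIV_add DERIV_cmult *)
    then show ?thesis by (simp add: B_def algebra_simps)
  qed
  have dBk: "((\<lambda>x. r * B (Suc (Suc n)) (k * (x - c0))) has_real_derivative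
      r * (real (Suc (Suc n)) * B (Suc n) (k * (x - c0)) * k)) (at x)" for n x r
  proof -
    have "((\<lambda>x. k * (x - c0)) has_real_derivative k) (at x)" by (auto intro!: derivative_eq_intros)
    then show ?thesis by (intro DERIV_cmult DERIV_chain2[OF dB])
  qed
  have left: "B n (k * (x - c0)) = 0" if "x \<le> c0" "n > 0" for n x
  proof -
    have "k * (x - c0) \<le> 0" using that k by (simp add: mult_nonneg_nonpos)
    then show ?thesis using that by (simp add: B_def max_def)
  qed
  have right: "k * (x - c0) \<ge> 3" if "x \<ge> c1" for x
    using that assms by (simp add: k_def field_simps)
  show thesis
  proof (rule that)
    show "((\<lambda>x. 1/6 * B 3 (k * (x - c0))) has_real_derivative (k / 2) * B 2 (k * (x - c0))) (at x)" for x
      using dBk[of "1/6" 1 x] by (simp add: eval_nat_numeral algebra_simps)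
    show "((\<lambda>x. (k / 2) * B 2 (k * (x - c0))) has_real_derivative k\<^sup>2 * B 1 (k * (x - c0))) (at x)" for x
      using dBk[of "k/2" 0 x] by (simp add: eval_nat_numeral algebra_simps)
    show "continuous_on UNIV (\<lambda>x. k\<^sup>2 * B 1 (k * (x - c0)))"
      unfolding B_def by (intro continuous_intros)
    show "1/6 * B 3 (k * (x - c0)) = 0 \<and> k / 2 * B 2 (k * (x - c0)) = 0 \<and> k\<^sup>2 * B 1 (k * (x - c0)) = 0"
      if "x \<le> c0" for x
      using left[OF that] by simp
    show "1/6 * B 3 (k * (x - c0)) = 1 \<and> k / 2 * B 2 (k * (x - c0)) = 0 \<and> k\<^sup>2 * B 1 (k * (x - c0)) = 0"
      if "x \<ge> c1" for x
      using right[OF that] by (simp add: B_def max_def) (simp add: power2_eq_square power3_eq_cube algebra_simps)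
  qed
qed

lemma einterval_left_subset: "c \<in> einterval a b \<Longrightarrow> einterval a (ereal c) \<subseteq> einterval a b"
  unfolding einterval_def by (blast intro: less_trans)

lemma eventually_at_left_ereal:
  assumes "c \<in> einterval a b" and "\<And>x. c < x \<Longrightarrow> x \<in> einterval a b \<Longrightarrow> P x"
  shows "eventually (\<lambda>y. P (real_of_ereal y)) (at_left b)"
proof -
  have "ereal c < b" using assms(1) by (simp add: einterval_iff)
  then have "eventually (\<lambda>y. y \<in> {ereal c<..<b}) (at_left b)"
    by (rule eventually_at_leftI[rotated]) auto
  then show ?thesis
  proof eventually_elim
    case (elim y)
    then obtain r where "y = ereal r" by (cases y) auto
    then have "r \<in> einterval (ereal c) b" using elim by (simp add: einterval_iff)
    then show ?case using \<open>y = ereal r\<close> assms einterval_right_subset[OF assms(1)] elim by auto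
  qed
qed

lemma eventually_at_right_ereal:
  assumes "c \<in> einterval a b" and "\<And>x. x < c \<Longrightarrow> x \<in> einterval a b \<Longrightarrow> P x"
  shows "eventually (\<lambda>y. P (real_of_ereal y)) (at_right a)"
proof -
  have "a < ereal c" using assms(1) by (simp add: einterval_iff)
  then have "eventually (\<lambda>y. y \<in> {a<..<ereal c}) (at_right a)"
    by (rule eventually_at_rightI[rotated]) auto
  then show ?thesis
  proof eventually_elim
    case (elim y)
    then obtain r where "y = ereal r" by (cases y) auto
    then have "r \<in> einterval a (ereal c)" using elim by (simp add: einterval_iff)
    then show ?case using \<open>y = ereal r\<close> assms einterval_left_subset[OF assms(1)] elim by auto
  qed
qed

section \<open>Membership in the graph of H and its symmetry\<close>

lemma H_op_memberI:
  assumes "f \<in> L2 a b" and "g \<in> L2 a b" and "tau_eq a b q f g"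
    and "bc_left a b q v f" and "bc_right a b q w f"
  shows "(f, g) \<in> H_op a b q v w"
  using assms unfolding H_op_def tau_operator_def ae_eq_def by auto

lemma self_adjoint_symmetric:
  assumes "self_adjoint a b A" and "(f, g) \<in> A" and "(u, h) \<in> A"
  shows "L2_inner a b f h = L2_inner a b g u"
  using assms unfolding self_adjoint_def L2_adjoint_def by blast

text \<open>Continuity settles the compact piece between \<open>c0\<close> and \<open>c\<close>. The
  lemma serves both for the cut-off solutions and for their images under the differential
  expression.\<close>

lemma L2_glue:
  assumes f: "continuous_on (einterval a b) f" and c: "c0 \<in> einterval a b" "c \<in> einterval a b"
    and f0: "\<And>x. x \<in> einterval a b \<Longrightarrow> x < c0 \<Longrightarrow> f x = 0"
    and fg: "\<And>x. x \<in> einterval a b \<Longrightarrow> c < x \<Longrightarrow> f x = g x"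
    and g: "g \<in> L2 (ereal c) b"
  shows "f \<in> L2 a b"
  unfolding L2_continuous_iff[OF f]
proof (rule absolutely_integrable_einterval_Un[OF _ _ _ c])
  show "loc_integrable a b (\<lambda>x. (cmod (f x))\<^sup>2)"
    using f by (intro loc_integrable_continuous continuous_intros)
  have "(\<lambda>x. 0 :: real) absolutely_integrable_on einterval a (ereal c0)" by simp
  then show "(\<lambda>x. (cmod (f x))\<^sup>2) absolutely_integrable_on einterval a (ereal c0)"
    by (rule set_integrable_cong[THEN iffD1, rotated -1]) 
      (use einterval_left_subset[OF c(1)] f0 in \<open>auto simp: einterval_iff\<close>)
  have "(\<lambda>x. (cmod (g x))\<^sup>2) absolutely_integrable_on einterval (ereal c) b"
    using g by (simp add: L2_iff)
  then show "(\<lambda>x. (cmod (f x))\<^sup>2) absolutely_integrable_on einterval (ereal c) b"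
    by (rule set_integrable_cong[THEN iffD1, rotated -1])
      (use einterval_right_subset[OF c(2)] fg in \<open>auto simp: einterval_iff\<close>)
qed


lemma vderiv_cnj:
  assumes "tau_eq a b q u g" and "x \<in> einterval a b"
  shows "vderiv (\<lambda>x. cnj (u x)) x = cnj (vderiv u x)"
  by (rule vector_derivative_at[OF has_vector_derivative_cnj[OF tau_eq_derivative[OF assms]]])

text \<open>Symmetry makes the integral of \<open>k\<close> over \<open>(a,b)\<close> vanish. That
  integral splits in three: nothing left of \<open>c0\<close>, the Wronskian at \<open>c\<close>
  from \<open>{c0..c}\<close> by Lagrange's identity, and a multiple of the wanted integral beyond
  \<open>c\<close>. No limit at \<open>b\<close> has to be computed.\<close>

lemma green_identity_right:
  assumes H: "self_adjoint a b (H_op a b q v w)" and c: "c \<in> einterval a b"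
    and u1: "solution a b q z1 u1" "in_domain_near_right a b q w u1"
    and u2: "solution a b q z2 u2" "in_domain_near_right a b q w u2"
  shows "(z2 - cnj z1) * integral (einterval (ereal c) b) (\<lambda>x. cnj (u1 x) * u2 x) =
    wronskian (\<lambda>x. cnj (u1 x)) u2 c"
proof -
  let ?E = "einterval a b" and ?R = "einterval (ereal c) b"
  have "a < ereal c" using c by (simp add: einterval_iff)
  then obtain c0 where "c0 \<in> einterval a (ereal c)" using einterval_nonempty by blast
  then have c0: "c0 \<in> ?E" "c0 < c" using einterval_left_subset[OF c] by (auto simp: einterval_iff)
  obtain \<eta> \<eta>' \<eta>'' :: "real \<Rightarrow> real"
    where \<eta>: "\<And>x. (\<eta> has_real_derivative \<eta>' x) (at x)" and \<eta>': "\<And>x. (\<eta>' has_real_derivative \<eta>'' x) (at x)"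
    and \<eta>'': "continuous_on UNIV \<eta>''"
    and left: "\<And>x. x \<le> c0 \<Longrightarrow> \<eta> x = 0 \<and> \<eta>' x = 0 \<and> \<eta>'' x = 0"
    and right: "\<And>x. x \<ge> c \<Longrightarrow> \<eta> x = 1 \<and> \<eta>' x = 0 \<and> \<eta>'' x = 0"
    using ex_C2_cutoff[OF c0(2)] by metis
  define F where "F u = (\<lambda>x. complex_of_real (\<eta> x) * u x)" for u :: "real \<Rightarrow> complex"
  define G where "G z u = (\<lambda>x. complex_of_real (\<eta> x) * (z * u x) - 2 * complex_of_real (\<eta>' x) * vderiv u x
      - complex_of_real (\<eta>'' x) * u x)" for z u
  have c\<eta>: "continuous_on ?E \<eta>" "continuous_on ?E \<eta>'" "continuous_on ?E \<eta>''"
    using \<eta> \<eta>' continuous_on_subset[OF \<eta>'']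
    by (auto intro!: continuous_at_imp_continuous_on intro: DERIV_isCont)
  have tauF: "tau_eq a b q (F u) (G z u)" if "solution a b q z u" for z u
    using tau_eq_cutoff[OF that[unfolded solution_def] \<eta> \<eta>' \<eta>''] by (simp add: F_def G_def)
  have dF: "vderiv (F u) x = complex_of_real (\<eta>' x) * u x + complex_of_real (\<eta> x) * vderiv u x"
    if "solution a b q z u" "x \<in> ?E" for z u x
    using vector_derivative_at[OF has_vector_derivative_mult[OF has_vector_derivative_of_real[OF \<eta>[of x]]
        tau_eq_derivative[OF that(1)[unfolded solution_def] that(2)]]]
    by (simp add: F_def add.commute)
  have mem: "(F u, G z u) \<in> H_op a b q v w" and L2F: "F u \<in> L2 a b" and L2G: "G z u \<in> L2 a b"
    if u: "solution a b q z u" and dom: "in_domain_near_right a b q w u" for z u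
  proof -
    note cu = tau_eq_continuous[OF u[unfolded solution_def]]
    have uR: "u \<in> L2 (ereal c) b"
      using dom cu(1) c by (auto simp: in_domain_near_right_def intro: L2_right)
    show L2F: "F u \<in> L2 a b"
      by (rule L2_glue[OF _ c0(1) c _ _ uR])
        (use left right cu c\<eta> in \<open>auto simp: F_def intro!: continuous_intros\<close>)
    show L2G: "G z u \<in> L2 a b"
      by (rule L2_glue[OF _ c0(1) c _ _ L2_cmult[OF uR, of z]])
        (use left right cu c\<eta> in \<open>auto simp: G_def intro!: continuous_intros\<close>)
    have "bc_left a b q v (F u)"
      unfolding bc_left_def wronskian_zero_left_def
    proof
      have "eventually (\<lambda>x. wronskian v (F u) (real_of_ereal x) = 0) (at_right a)"
        by (rule eventually_at_right_ereal[OF c0(1)]) (use left dF[OF u] in \<open>simp add: wronskian_def F_def\<close>)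
      then show "((\<lambda>x. wronskian v (F u) (real_of_ereal x)) \<longlongrightarrow> 0) (at_right a)"
        by (rule tendsto_eventually)
    qed
    moreover have "bc_right a b q w (F u)"
      unfolding bc_right_def wronskian_zero_right_def
    proof
      assume "limit_circle_right a b q"
      then have "((\<lambda>x. wronskian w u (real_of_ereal x)) \<longlongrightarrow> 0) (at_left b)"
        using dom by (simp add: in_domain_near_right_def bc_right_def wronskian_zero_right_def)
      moreover have "eventually (\<lambda>x. wronskian w u (real_of_ereal x) = wronskian w (F u) (real_of_ereal x)) (at_left b)"
        by (rule eventually_at_left_ereal[OF c]) (use right dF[OF u] in \<open>simp add: wronskian_def F_def\<close>)
      ultimately show "((\<lambda>x. wronskian w (F u) (real_of_ereal x)) \<longlongrightarrow> 0) (at_left b)"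
        by (rule Lim_transform_eventually)
    qed
    ultimately show "(F u, G z u) \<in> H_op a b q v w"
      using L2F L2G tauF[OF u] by (intro H_op_memberI)
  qed
  note L2s = L2F[OF u1] L2F[OF u2] L2G[OF u1] L2G[OF u2]
  \<comment> \<open>This is the derivative of the Wronskian of \<open>cnj (F u1)\<close> and
    \<open>F u2\<close>, so its integrals are at once differences of inner products and differences
    of boundary values.\<close>
  define k where "k = (\<lambda>x. cnj (G z1 u1 x) * F u2 x - cnj (F u1 x) * G z2 u2 x)"
  have "L2_inner a b (F u1) (G z2 u2) = L2_inner a b (G z1 u1) (F u2)"
    by (rule self_adjoint_symmetric[OF H mem[OF u1] mem[OF u2]])
  moreover have "integral ?E k = L2_inner a b (G z1 u1) (F u2) - L2_inner a b (F u1) (G z2 u2)"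
    unfolding k_def L2_inner_eq[OF L2s(3,2)] L2_inner_eq[OF L2s(1,4)]
    by (intro Henstock_Kurzweil_Integration.integral_diff set_lebesgue_integral_eq_integral(1) L2_mult L2_cnj L2s)
  ultimately have "integral ?E k = 0" by simp
  have tau1: "tau_eq a b q (\<lambda>x. cnj (F u1 x)) (\<lambda>x. cnj (G z1 u1 x))"
    by (rule tau_eq_cnj[OF tauF[OF u1(1)]])
  have k_int: "k absolutely_integrable_on ?E"
    unfolding k_def by (intro set_integral_diff L2_mult L2_cnj L2s)
  have W: "integral {c0..c} k = wronskian (\<lambda>x. cnj (F u1 x)) (F u2) c - wronskian (\<lambda>x. cnj (F u1 x)) (F u2) c0"
    using lagrange_integral[OF tau1 tauF[OF u2(1)] c0(1) c] c0(2) by (simp add: k_def)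
  have dF1: "vderiv (\<lambda>x. cnj (F u1 x)) x = cnj (vderiv (F u1) x)" if "x \<in> ?E" for x
    by (rule vderiv_cnj[OF tauF[OF u1(1)] that])
  have du1: "vderiv (\<lambda>x. cnj (u1 x)) x = cnj (vderiv u1 x)" if "x \<in> ?E" for x
    by (rule vderiv_cnj[OF u1(1)[unfolded solution_def] that])
  have W0: "wronskian (\<lambda>x. cnj (F u1 x)) (F u2) c0 = 0"
    using left[of c0] dF1[OF c0(1)] dF[OF u1(1) c0(1)] by (simp add: wronskian_def F_def)
  have Wc: "wronskian (\<lambda>x. cnj (F u1 x)) (F u2) c = wronskian (\<lambda>x. cnj (u1 x)) u2 c"
    using right[of c] dF1[OF c] du1[OF c] dF[OF u1(1) c] dF[OF u2(1) c] by (simp add: wronskian_def F_def)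
  have kR: "k x = (cnj z1 - z2) * (cnj (u1 x) * u2 x)" if "x \<in> ?R" for x
    using right[of x] that by (simp add: k_def F_def G_def einterval_iff algebra_simps)
  have kR': "integral ?R k = (cnj z1 - z2) * integral ?R (\<lambda>x. cnj (u1 x) * u2 x)"
    by (subst Henstock_Kurzweil_Integration.integral_cong[OF kR]) auto
  have i1: "(k has_integral wronskian (\<lambda>x. cnj (u1 x)) u2 c) {c0..c}"
  proof -
    have "k integrable_on {c0..c}"
      by (intro set_lebesgue_integral_eq_integral(1) set_integrable_subset[OF k_int])
        (use einterval_Icc_subset[OF c0(1) c] in auto)
    then show ?thesis using W W0 Wc by (simp add: has_integral_iff)
  qed
  have i2: "(k has_integral integral ?R k) ?R"
    by (intro integrable_integral set_lebesgue_integral_eq_integral(1) set_integrable_subset[OF k_int]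
        einterval_right_subset[OF c]) auto
  have "(k has_integral (wronskian (\<lambda>x. cnj (u1 x)) u2 c + integral ?R k)) ({c0..c} \<union> ?R)"
    by (rule has_integral_Un[OF i1 i2]) (auto simp: einterval_iff intro: negligible_subset[of "{}"])
  then have "((\<lambda>x. if x \<in> {c0..c} \<union> ?R then k x else 0) has_integral
      (wronskian (\<lambda>x. cnj (u1 x)) u2 c + integral ?R k)) ?E"
    using einterval_right_subset[OF c] einterval_Icc_subset[OF c0(1) c] by (subst has_integral_restrict) auto
  then have "(k has_integral (wronskian (\<lambda>x. cnj (u1 x)) u2 c + integral ?R k)) ?E"
  proof (rule has_integral_eq[rotated])
    fix x assume "x \<in> ?E"
    then show "(if x \<in> {c0..c} \<union> ?R then k x else 0) = k x"
      using left[of x] by (auto simp: k_def F_def G_def einterval_iff)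
  qed
  then have "wronskian (\<lambda>x. cnj (u1 x)) u2 c + integral ?R k = 0"
    using \<open>integral ?E k = 0\<close> by (simp add: integral_unique)
  then show ?thesis unfolding kR' by (simp add: algebra_simps)
qed

section \<open>Weyl's alternative\<close>

lemma integral_subinterval_le:
  fixes h :: "real \<Rightarrow> real"
  assumes "continuous_on {x..y} h" and "\<And>t. t \<in> {x..y} \<Longrightarrow> 0 \<le> h t" and "{x'..y'} \<subseteq> {x..y}"
  shows "integral {x'..y'} h \<le> integral {x..y} h"
  using assms by (intro integral_subset_le integrable_continuous_real) (auto intro: continuous_on_subset)

lemma at_left_neq_bot:
  fixes b c :: ereal
  assumes "c < b"
  shows "at_left b \<noteq> bot"
proof
  assume "at_left b = bot"
  then have "eventually (\<lambda>_. False) (at_left b)" by simp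
  then obtain e where "e < b" "\<And>y. e < y \<Longrightarrow> \<not> y < b"
    using eventually_at_left[OF assms] by auto
  then show False using dense by blast
qed

lemma integral_cnj_mult_self:
  fixes f :: "'a::euclidean_space \<Rightarrow> complex"
  assumes "(\<lambda>x. (cmod (f x))\<^sup>2) integrable_on S"
  shows "integral S (\<lambda>x. cnj (f x) * f x) = complex_of_real (integral S (\<lambda>x. (cmod (f x))\<^sup>2))"
proof -
  have "(\<lambda>x. cnj (f x) * f x) = complex_of_real \<circ> (\<lambda>x. (cmod (f x))\<^sup>2)"
    by (simp add: fun_eq_iff complex_norm_square mult.commute del: of_real_power)
  then show ?thesis using integral_linear[OF assms bounded_linear_of_real] by metis
qed

lemma zero_if_integral_norm_square_zero:
  assumes f: "f \<in> L2 a b" "continuous_on (einterval a b) f"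
    and 0: "integral (einterval a b) (\<lambda>x. cnj (f x) * f x) = 0" and x: "x \<in> einterval a b"
  shows "f x = 0"
proof -
  let ?E = "einterval a b"
  have int: "(\<lambda>x. (cmod (f x))\<^sup>2) integrable_on ?E"
    using f(1) by (auto simp: L2_iff set_lebesgue_integral_eq_integral(1))
  then have I0: "integral ?E (\<lambda>x. (cmod (f x))\<^sup>2) = 0"
    using 0 by (simp add: integral_cnj_mult_self)
  obtain e where e: "e > 0" "cball x e \<subseteq> ?E"
    using x open_contains_cball[of ?E] open_einterval by blast
  define X Y where "X = x - e" and "Y = x + e"
  have XY: "X < x" "x < Y" and sub: "{X..Y} \<subseteq> ?E"
    using e by (auto simp: X_def Y_def cball_def dist_real_def subset_iff)
  have cont: "continuous_on {X..Y} (\<lambda>x. (cmod (f x))\<^sup>2)"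
    using continuous_on_subset[OF f(2) sub] by (intro continuous_intros)
  have "integral {X..Y} (\<lambda>x. (cmod (f x))\<^sup>2) \<le> integral ?E (\<lambda>x. (cmod (f x))\<^sup>2)"
    by (intro integral_subset_le sub int integrable_continuous_real cont) auto
  moreover have "0 \<le> integral {X..Y} (\<lambda>x. (cmod (f x))\<^sup>2)"
    by (intro Henstock_Kurzweil_Integration.integral_nonneg integrable_continuous_real cont) auto
  ultimately have "integral {X..Y} (\<lambda>x. (cmod (f x))\<^sup>2) = 0" using I0 by simp
  then have "((\<lambda>x. (cmod (f x))\<^sup>2) has_integral 0) (cbox X Y)"
    using integrable_continuous_real[OF cont] by (simp add: has_integral_iff)
  then have "(cmod (f x))\<^sup>2 = 0"
    using XY cont by (intro has_integral_0_cbox_imp_0[of X Y "\<lambda>x. (cmod (f x))\<^sup>2"]) auto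
  then show ?thesis by simp
qed

lemma solution_lincomb:
  assumes "solution a b q z u" and "solution a b q z v"
  shows "solution a b q z (\<lambda>x. \<alpha> * u x + \<beta> * v x)"
  using tau_eq_lincomb[of a b q u "\<lambda>x. z * u x" v "\<lambda>x. z * v x" \<alpha> \<beta>] assms
  unfolding solution_def by (simp add: algebra_simps)

lemma vderiv_lincomb:
  assumes "solution a b q z u" and "solution a b q z v" and "x \<in> einterval a b"
  shows "vderiv (\<lambda>x. \<alpha> * u x + \<beta> * v x) x = \<alpha> * vderiv u x + \<beta> * vderiv v x"
  by (intro vector_derivative_at has_vector_derivative_add has_vector_derivative_mult_right
      tau_eq_derivative[OF assms(1)[unfolded solution_def]] tau_eq_derivative[OF assms(2)[unfolded solution_def]] assms(3))

text \<open>Three vectors in a two-dimensional space are dependent. Solved for \<open>f\<close>, the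
  relation expands \<open>f\<close> in \<open>g\<close> and \<open>h\<close> with Wronskians as
  coefficients, at a point and without any equation for \<open>f\<close>.\<close>

lemma wronskian_plucker:
  "f x * wronskian g h x + g x * wronskian h f x + h x * wronskian f g x = 0"
  by (simp add: wronskian_def algebra_simps)

text \<open>Lagrange's identity for \<open>u\<close> and its conjugate, which solves the equation
  for \<open>cnj z\<close>. It ties the norm on a compact interval to boundary data and is the
  source of Weyl's discs.\<close>

lemma wronskian_norm:
  assumes u: "solution a b q z u" and xy: "x \<in> einterval a b" "y \<in> einterval a b" "x \<le> y"
  shows "wronskian (\<lambda>t. cnj (u t)) u y = wronskian (\<lambda>t. cnj (u t)) u x
    - 2 * \<i> * Im z * complex_of_real (integral {x..y} (\<lambda>t. (cmod (u t))\<^sup>2))"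
proof -
  have "continuous_on {x..y} u"
    using tau_eq_continuous(1)[OF u[unfolded solution_def]] einterval_Icc_subset[OF xy(1,2)]
    by (rule continuous_on_subset)
  then have int: "(\<lambda>t. (cmod (u t))\<^sup>2) integrable_on {x..y}"
    by (intro integrable_continuous_real continuous_intros)
  have "wronskian (\<lambda>t. cnj (u t)) u y - wronskian (\<lambda>t. cnj (u t)) u x
      = integral {x..y} (\<lambda>t. cnj (z * u t) * u t - cnj (u t) * (z * u t))"
    by (rule lagrange_integral[symmetric, OF tau_eq_cnj[OF u[unfolded solution_def]] u[unfolded solution_def] xy])
  also have "\<dots> = integral {x..y} (\<lambda>t. (cnj z - z) * (cnj (u t) * u t))"
    by (intro Henstock_Kurzweil_Integration.integral_cong) (simp add: algebra_simps)
  also have "\<dots> = (cnj z - z) * complex_of_real (integral {x..y} (\<lambda>t. (cmod (u t))\<^sup>2))"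
    by (simp add: integral_cnj_mult_self[OF int])
  also have "cnj z - z = - (2 * \<i> * Im z)"
    by (simp add: complex_eq_iff)
  finally show ?thesis by (simp add: algebra_simps)
qed

section \<open>Solutions normalized at c, and independence of the limit circle case of z\<close>

locale fundamental_system =
  fixes a b :: ereal and q :: "real \<Rightarrow> real" and c :: real and C S :: "complex \<Rightarrow> real \<Rightarrow> complex"
  assumes c: "c \<in> einterval a b"
    and C: "\<And>z. solution a b q z (C z) \<and> C z c = 1 \<and> vderiv (C z) c = 0"
    and S: "\<And>z. solution a b q z (S z) \<and> S z c = 0 \<and> vderiv (S z) c = 1"
begin

lemma wronskian_C_S: "x \<in> einterval a b \<Longrightarrow> wronskian (C z) (S z) x = 1"
  using wronskian_solutions_const[of a b q z "C z" "S z" x c] C[of z] S[of z] c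
  by (simp add: wronskian_def)

text \<open>Constancy of Wronskians alone shows that the data at \<open>c\<close> determine a
  solution; no uniqueness theorem for initial value problems is invoked.\<close>

lemma solution_expand:
  assumes u: "solution a b q z u" and x: "x \<in> einterval a b"
  shows "u x = u c * C z x + vderiv u c * S z x"
proof -
  have "wronskian (S z) u x = - u c" "wronskian u (C z) x = - vderiv u c"
    using wronskian_solutions_const[of a b q z _ _ x c] u x c C[of z] S[of z]
    by (auto simp: wronskian_def)
  then show ?thesis
    using wronskian_plucker[of u x "C z" "S z"] wronskian_C_S[OF x, of z]
    by (simp add: algebra_simps add_eq_0_iff)
qed

lemma solution_lincomb_C_S: "solution a b q z (\<lambda>x. \<alpha> * C z x + \<beta> * S z x)"
  using C S by (intro solution_lincomb) auto

lemma S_not_identically_zero: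
  assumes "d \<in> einterval a b" and "c < d"
  shows "\<exists>x\<in>{c<..<d}. S z x \<noteq> 0"
proof (rule ccontr)
  assume "\<not> ?thesis"
  then have 0: "S z x = 0" if "x \<in> {c<..<d}" for x using that by blast
  obtain x where x: "x \<in> {c<..<d}" using dense[OF \<open>c < d\<close>] by auto
  have "((\<lambda>x. 0) has_vector_derivative 0) (at x)" by simp
  then have "(S z has_vector_derivative 0) (at x)"
    by (rule has_vector_derivative_transform_within_open[where S = "{c<..<d}"]) (use x 0 in auto)
  then have "vderiv (S z) x = 0" by (rule vector_derivative_at)
  moreover have "x \<in> einterval a b"
    using einterval_Icc_subset[OF c assms(1)] x by auto
  ultimately show False using wronskian_C_S[of x z] 0[OF x] by (simp add: wronskian_def)
qed

text \<open>Variation of constants: \<open>u\<close> is a combination of two square integrable solutions for \<open>z0\<close> with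
  Wronskians as coefficients. Close enough to \<open>b\<close> the growth of these coefficients is absorbed.\<close>

lemma weyl_alternative:
  assumes lc: "limit_circle_right a b q" and u: "solution a b q z u"
  shows "L2_near_right a b u"
proof -
  let ?E = "einterval a b"
  obtain z0 where z0: "\<And>u. solution a b q z0 u \<Longrightarrow> L2_near_right a b u"
    using lc by (auto simp: limit_circle_right_def)
  define y1 y2 where "y1 = C z0" and "y2 = S z0"
  have sol: "solution a b q z0 y1" "solution a b q z0 y2" using C S by (auto simp: y1_def y2_def)
  note cont = tau_eq_continuous(1)[OF sol(1)[unfolded solution_def]] tau_eq_continuous(1)[OF sol(2)[unfolded solution_def]]
    tau_eq_continuous(1)[OF u[unfolded solution_def]]
  define Y where "Y x = (cmod (y1 x))\<^sup>2 + (cmod (y2 x))\<^sup>2" for x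
  have contY: "continuous_on ?E Y" unfolding Y_def by (intro continuous_intros cont)
  have "y1 \<in> L2 (ereal c) b" "y2 \<in> L2 (ereal c) b"
    using z0 sol cont c by (auto intro: L2_right)
  then have Yint: "Y absolutely_integrable_on einterval (ereal c) b"
    unfolding Y_def L2_iff by (intro set_integral_add) auto
  have cb: "ereal c < b" using c by (simp add: einterval_iff)
  define \<mu> where "\<mu> = cmod (z0 - z)"
  \<comment> \<open>Chosen such that the factor \<open>4 * \<mu>\<^sup>2 * e\<^sup>2\<close> in the
    final estimate of \<open>N x\<close> is at most one half. The summand 1 covers
    \<open>\<mu> = 0\<close>.\<close>
  define e where "e = 1 / (4 * (\<mu> + 1))"
  have \<mu>: "\<mu> \<ge> 0" by (simp add: \<mu>_def)
  have e: "e > 0" and e\<mu>: "4 * \<mu>\<^sup>2 * e\<^sup>2 \<le> 1 / 2"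
  proof -
    show "e > 0" using \<mu> by (simp add: e_def)
    have "\<mu> * e \<le> 1 / 4" using \<mu> by (simp add: e_def field_simps)
    then have "(\<mu> * e)\<^sup>2 \<le> (1 / 4)\<^sup>2" using \<mu> \<open>e > 0\<close> by (intro power_mono) auto
    then show "4 * \<mu>\<^sup>2 * e\<^sup>2 \<le> 1 / 2" by (simp add: power2_eq_square algebra_simps)
  qed
  define T where "T = integral (einterval (ereal c) b) Y"
  have "eventually (\<lambda>x. integral {c..real_of_ereal x} Y > T - e) (at_left b)"
    using integral_einterval_tendsto[OF Yint cb] e unfolding T_def by (intro order_tendstoD(1)) auto
  moreover have "eventually (\<lambda>x. c < real_of_ereal x \<and> real_of_ereal x \<in> ?E) (at_left b)"
    by (rule eventually_at_left_ereal[OF c]) auto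
  ultimately have "eventually (\<lambda>x. integral {c..real_of_ereal x} Y > T - e \<and>
      c < real_of_ereal x \<and> real_of_ereal x \<in> ?E) (at_left b)"
    by (rule eventually_conj)
  from eventually_happens'[OF at_left_neq_bot[OF cb] this]
  \<comment> \<open>From \<open>d\<close> on, \<open>Y\<close> has total mass less than
    \<open>e\<close>.\<close>
  obtain d where d: "c < d" "d \<in> ?E" "integral {c..d} Y > T - e" by blast
  have Ysmall: "integral {d..x} Y \<le> e" if "x \<in> ?E" "d \<le> x" for x
  proof -
    have "integral {c..x} Y = integral {c..d} Y + integral {d..x} Y"
      using that d(1) einterval_Icc_subset[OF c that(1)]
      by (intro Henstock_Kurzweil_Integration.integral_combine[symmetric] integrable_continuous_real
          continuous_on_subset[OF contY]) auto
    moreover have "integral {c..x} Y \<le> T"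
    proof -
      have sub: "{c<..<x} \<subseteq> einterval (ereal c) b"
        using that(1) by (auto simp: einterval_iff) (metis ereal_less_eq(3) less_imp_le le_less_trans)
      have "integral {c<..<x} Y \<le> T"
        unfolding T_def using Yint sub
        by (intro integral_subset_le set_lebesgue_integral_eq_integral(1) set_integrable_subset[OF Yint])
          (auto simp: Y_def)
      then show ?thesis by (simp add: integral_open_interval_real)
    qed
    ultimately show ?thesis using d(3) by simp
  qed
  define N where "N x = integral {d..x} (\<lambda>t. (cmod (u t))\<^sup>2)" for x
  define K where "K = 2 * (cmod (wronskian y1 u d))\<^sup>2 + 2 * (cmod (wronskian y2 u d))\<^sup>2"
  \<comment> \<open>The Wronskian departs from its value at \<open>d\<close> by
    \<open>z0 - z\<close> times the integral of \<open>y * u\<close>. Cauchy-Schwarz bounds this by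
    the small mass of \<open>y\<close> beyond \<open>d\<close> and by \<open>N x\<close>.\<close>
  have wbound: "(cmod (wronskian y u t))\<^sup>2 \<le> K + 2 * \<mu>\<^sup>2 * e * N x"
    if y: "y = y1 \<or> y = y2" and x: "x \<in> ?E" and t: "t \<in> {d..x}" for y x t
  proof -
    have tE: "t \<in> ?E" using einterval_Icc_subset[OF d(2) x] t by auto
    have soly: "solution a b q z0 y" using y sol by auto
    have conty: "continuous_on ?E y" using y cont by auto
    have sub: "{d..t} \<subseteq> ?E" "{d..x} \<subseteq> ?E" using einterval_Icc_subset[OF d(2)] tE x by auto
    have L: "wronskian y u t - wronskian y u d = (z0 - z) * integral {d..t} (\<lambda>s. y s * u s)"
    proof -
      have "wronskian y u t - wronskian y u d = integral {d..t} (\<lambda>s. z0 * y s * u s - y s * (z * u s))"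
        using lagrange_integral[OF soly[unfolded solution_def] u[unfolded solution_def] d(2) tE] t by simp
      also have "\<dots> = integral {d..t} (\<lambda>s. (z0 - z) * (y s * u s))"
        by (intro Henstock_Kurzweil_Integration.integral_cong) (simp add: algebra_simps)
      finally show ?thesis by simp
    qed
    have L2: "f \<in> L2 (ereal d) (ereal t)" if "continuous_on ?E f" for f
    proof -
      have "continuous_on {d..t} f" using that sub(1) by (rule continuous_on_subset)
      then have "(\<lambda>s. (cmod (f s))\<^sup>2) absolutely_integrable_on {d..t}"
        by (intro absolutely_integrable_continuous_real continuous_intros)
      moreover have "{d<..<t} \<subseteq> ?E" by (rule subset_trans[OF _ sub(1)]) auto
      ultimately show ?thesis
        using continuous_on_subset[OF that, of "{d<..<t}"]
        by (subst L2_continuous_iff) (auto intro: set_integrable_subset)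
    qed
    have "(cmod (integral {d..t} (\<lambda>s. y s * u s)))\<^sup>2 \<le>
        integral {d..t} (\<lambda>s. (cmod (y s))\<^sup>2) * integral {d..t} (\<lambda>s. (cmod (u s))\<^sup>2)"
      using L2_Cauchy_Schwarz[OF L2[OF conty] L2[OF cont(3)]] by (simp add: integral_open_interval_real)
    also have "\<dots> \<le> e * N x"
    proof (rule mult_mono)
      have "integral {d..t} (\<lambda>s. (cmod (y s))\<^sup>2) \<le> integral {d..t} Y"
        using y conty contY sub(1)
        by (intro integral_le integrable_continuous_real continuous_intros)
          (auto intro: continuous_on_subset simp: Y_def)
      also have "\<dots> \<le> e" using Ysmall[OF tE] t by simp
      finally show "integral {d..t} (\<lambda>s. (cmod (y s))\<^sup>2) \<le> e" .
      show "integral {d..t} (\<lambda>s. (cmod (u s))\<^sup>2) \<le> N x" unfolding N_def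
        using t continuous_on_subset[OF cont(3) sub(2)]
        by (intro integral_subinterval_le continuous_intros) auto
      show "0 \<le> integral {d..t} (\<lambda>s. (cmod (u s))\<^sup>2)"
        using continuous_on_subset[OF cont(3) sub(1)]
        by (intro Henstock_Kurzweil_Integration.integral_nonneg integrable_continuous_real continuous_intros) auto
    qed (use e in auto)
    finally have CS: "(cmod (integral {d..t} (\<lambda>s. y s * u s)))\<^sup>2 \<le> e * N x" .
    have "(cmod (wronskian y u t))\<^sup>2 = (cmod (wronskian y u d + (z0 - z) * integral {d..t} (\<lambda>s. y s * u s)))\<^sup>2"
      by (simp flip: L)
    also have "\<dots> \<le> 2 * (cmod (wronskian y u d))\<^sup>2 + 2 * (\<mu>\<^sup>2 * (cmod (integral {d..t} (\<lambda>s. y s * u s)))\<^sup>2)"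
      using cmod_add_square_le[of "wronskian y u d" "(z0 - z) * integral {d..t} (\<lambda>s. y s * u s)"]
      unfolding \<mu>_def norm_mult power_mult_distrib .
    also have "\<dots> \<le> K + 2 * (\<mu>\<^sup>2 * (e * N x))"
      using y CS by (intro add_mono mult_left_mono) (auto simp: K_def)
    finally show ?thesis by (simp add: algebra_simps)
  qed
  have pointwise: "(cmod (u t))\<^sup>2 \<le> Y t * (2 * (K + 2 * \<mu>\<^sup>2 * e * N x))"
    if x: "x \<in> ?E" and t: "t \<in> {d..x}" for x t
  proof -
    have tE: "t \<in> ?E" using einterval_Icc_subset[OF d(2) x] t by auto
    have "u t = y2 t * wronskian y1 u t + (- y1 t * wronskian y2 u t)"
      using wronskian_plucker[of u t y1 y2] wronskian_C_S[OF tE, of z0]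
      by (simp add: y1_def y2_def wronskian_def algebra_simps)
    then have "(cmod (u t))\<^sup>2 \<le> 2 * (cmod (y2 t))\<^sup>2 * (cmod (wronskian y1 u t))\<^sup>2
        + 2 * (cmod (y1 t))\<^sup>2 * (cmod (wronskian y2 u t))\<^sup>2"
      using cmod_add_square_le[of "y2 t * wronskian y1 u t" "- y1 t * wronskian y2 u t"]
      by (simp add: norm_mult power_mult_distrib)
    also have "\<dots> \<le> 2 * (cmod (y2 t))\<^sup>2 * (K + 2 * \<mu>\<^sup>2 * e * N x) + 2 * (cmod (y1 t))\<^sup>2 * (K + 2 * \<mu>\<^sup>2 * e * N x)"
      using wbound[OF _ x t] by (intro add_mono mult_left_mono) auto
    finally show ?thesis by (simp add: Y_def algebra_simps)
  qed
  have bound: "N x \<le> 4 * e * K" if x: "x \<in> ?E" "d < x" for x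
  proof -
    have sub: "{d..x} \<subseteq> ?E" by (rule einterval_Icc_subset[OF d(2) x(1)])
    have N0: "N x \<ge> 0" unfolding N_def using continuous_on_subset[OF cont(3) sub]
      by (intro Henstock_Kurzweil_Integration.integral_nonneg integrable_continuous_real continuous_intros) auto
    have "N x \<le> integral {d..x} (\<lambda>t. Y t * (2 * (K + 2 * \<mu>\<^sup>2 * e * N x)))"
      unfolding N_def[of x] using pointwise[OF x(1)] continuous_on_subset[OF cont(3) sub] continuous_on_subset[OF contY sub]
      by (intro integral_le integrable_continuous_real continuous_intros) (auto simp: N_def)
    also have "\<dots> = integral {d..x} Y * (2 * (K + 2 * \<mu>\<^sup>2 * e * N x))" by simp
    also have "\<dots> \<le> e * (2 * (K + 2 * \<mu>\<^sup>2 * e * N x))"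
      using Ysmall[OF x(1)] x(2) N0 e by (intro mult_right_mono) (auto simp: K_def)
    also have "\<dots> = 2 * e * K + (4 * \<mu>\<^sup>2 * e\<^sup>2) * N x" by (simp add: algebra_simps power2_eq_square)
    \<comment> \<open>\<open>N x\<close> is finite, being an integral over a compact interval, so
      half of it can be moved to the left. The resulting bound \<open>4 * e * K\<close> no longer
      depends on \<open>x\<close>.\<close>
    also have "\<dots> \<le> 2 * e * K + 1 / 2 * N x" using e\<mu> N0 by (intro add_left_mono mult_right_mono)
    finally show ?thesis by simp
  qed
  have "(\<lambda>t. (cmod (u t))\<^sup>2) absolutely_integrable_on einterval (ereal d) b"
    using bound cont(3) d(2) unfolding N_def
    by (intro absolutely_integrable_if_bounded[of a b _ d "4 * e * K"] loc_integrable_continuous continuous_intros) auto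
  moreover have "continuous_on (einterval (ereal d) b) u"
    using cont(3) einterval_right_subset[OF d(2)] by (rule continuous_on_subset)
  ultimately have "u \<in> L2 (ereal d) b" by (simp add: L2_continuous_iff)
  then show ?thesis using d(2) by (auto simp: L2_near_right_def)
qed

end

section \<open>Existence of the Weyl solution\<close>

text \<open>Here \<open>f'\<close> and \<open>g'\<close> are the images under the differential
  expression, not derivatives. The integrand in Lagrange's identity is then integrable up to
  \<open>b\<close>.\<close>

lemma wronskian_tendsto_right:
  assumes f: "tau_eq a b q f f'" and g: "tau_eq a b q g g'" and c: "c \<in> einterval a b"
    and L2: "f \<in> L2 (ereal c) b" "f' \<in> L2 (ereal c) b" "g \<in> L2 (ereal c) b" "g' \<in> L2 (ereal c) b"
  shows "\<exists>L. ((\<lambda>x. wronskian f g (real_of_ereal x)) \<longlongrightarrow> L) (at_left b)"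
proof -
  let ?h = "\<lambda>t. f' t * g t - f t * g' t"
  have "?h absolutely_integrable_on einterval (ereal c) b"
    by (intro set_integral_diff L2_mult L2)
  then have "((\<lambda>x. integral {c..real_of_ereal x} ?h) \<longlongrightarrow> integral (einterval (ereal c) b) ?h) (at_left b)"
    using c by (intro integral_einterval_tendsto) (auto simp: einterval_iff)
  then have "((\<lambda>x. wronskian f g c + integral {c..real_of_ereal x} ?h) \<longlongrightarrow>
      wronskian f g c + integral (einterval (ereal c) b) ?h) (at_left b)"
    by (intro tendsto_intros)
  moreover have "eventually (\<lambda>x. wronskian f g c + integral {c..real_of_ereal x} ?h =
      wronskian f g (real_of_ereal x)) (at_left b)"
  proof (rule eventually_at_left_ereal[OF c])
    fix x assume "c < x" "x \<in> einterval a b"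
    then show "wronskian f g c + integral {c..x} ?h = wronskian f g x"
      using lagrange_integral[OF f g c, of x] by simp
  qed
  ultimately show ?thesis by (intro exI) (rule Lim_transform_eventually)
qed

text \<open>For \<open>t > 1\<close> the inequality can be divided by \<open>t\<close>; the summand
  1 covers the rest.\<close>

lemma linear_bound_if_quadratic:
  fixes A \<alpha> \<beta> t :: real
  assumes "A > 0" "\<alpha> \<ge> 0" "\<beta> \<ge> 0" "A * t\<^sup>2 \<le> \<alpha> * t + \<beta>" "t \<ge> 0"
  shows "t \<le> (\<alpha> + \<beta>) / A + 1"
proof (cases "t \<le> 1")
  case True
  then show ?thesis using assms by (intro order_trans[OF True]) auto
next
  case False
  then have "t > 1" by simp
  have "A * t * t \<le> (\<alpha> + \<beta>) * t"
    using assms(3,4) mult_left_mono[of 1 t \<beta>] \<open>t > 1\<close> by (simp add: power2_eq_square algebra_simps)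
  then have "A * t \<le> \<alpha> + \<beta>" using \<open>t > 1\<close> by simp
  then have "t \<le> (\<alpha> + \<beta>) / A" using assms(1) by (simp add: field_simps)
  then show ?thesis by simp
qed

section \<open>Weyl's discs and the existence of m\<close>

context fundamental_system
begin

text \<open>The square of the norm: a quadratic function of \<open>m\<close>, whose comparison with
  a linear one cuts out a disc.\<close>

definition weyl_norm :: "complex \<Rightarrow> real \<Rightarrow> complex \<Rightarrow> real" where
  "weyl_norm z d m = integral {c..d} (\<lambda>t. (cmod (C z t + m * S z t))\<^sup>2)"

lemma continuous_on_C_S:
  "continuous_on (einterval a b) (C z)" "continuous_on (einterval a b) (S z)"
  using C[of z] S[of z] by (auto simp: solution_def intro: tau_eq_continuous)

lemma solution_weyl: "solution a b q z (\<lambda>x. C z x + m * S z x)"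
  using solution_lincomb_C_S[of z 1 m] by simp

lemma vderiv_weyl:
  "x \<in> einterval a b \<Longrightarrow> vderiv (\<lambda>x. C z x + m * S z x) x = vderiv (C z) x + m * vderiv (S z) x"
  using vderiv_lincomb[of a b q z "C z" "S z" x 1 m] C[of z] S[of z] by simp

lemma square_norm_S_pos:
  assumes "d \<in> einterval a b" "c < d"
  shows "0 < integral {c..d} (\<lambda>t. (cmod (S z t))\<^sup>2)"
proof -
  have cont: "continuous_on {c..d} (\<lambda>t. (cmod (S z t))\<^sup>2)"
    by (intro continuous_intros continuous_on_subset[OF continuous_on_C_S(2) einterval_Icc_subset[OF c assms(1)]])
  have ge: "0 \<le> integral {c..d} (\<lambda>t. (cmod (S z t))\<^sup>2)"
    by (intro Henstock_Kurzweil_Integration.integral_nonneg integrable_continuous_real cont) auto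
  obtain x where x: "x \<in> {c<..<d}" "S z x \<noteq> 0" using S_not_identically_zero[OF assms] by blast
  have "integral {c..d} (\<lambda>t. (cmod (S z t))\<^sup>2) \<noteq> 0"
  proof
    assume "integral {c..d} (\<lambda>t. (cmod (S z t))\<^sup>2) = 0"
    then have "((\<lambda>t. (cmod (S z t))\<^sup>2) has_integral 0) (cbox c d)"
      using integrable_continuous_real[OF cont] by (simp add: has_integral_iff)
    then have "(cmod (S z x))\<^sup>2 = 0"
      using x cont by (intro has_integral_0_cbox_imp_0[of c d "\<lambda>t. (cmod (S z t))\<^sup>2"]) auto
    then show False using x by simp
  qed
  then show ?thesis using ge by simp
qed

text \<open>A zero at \<open>d\<close> would make \<open>z\<close> a nonreal Dirichlet eigenvalue of
  the regular problem on \<open>{c..d}\<close>: the Wronskian with the conjugate would vanish at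
  both ends and force norm zero.\<close>

lemma S_nonzero:
  assumes "Im z \<noteq> 0" "d \<in> einterval a b" "c < d"
  shows "S z d \<noteq> 0"
proof
  assume 0: "S z d = 0"
  have "wronskian (\<lambda>t. cnj (S z t)) (S z) d = 0" "wronskian (\<lambda>t. cnj (S z t)) (S z) c = 0"
    using 0 S[of z] vderiv_cnj[of a b q "S z" "\<lambda>x. z * S z x"] c assms(2) by (auto simp: wronskian_def solution_def)
  then show False
    using wronskian_norm[of a b q z "S z" c d] S[of z] c assms square_norm_S_pos[OF assms(2,3), of z] by simp
qed

text \<open>For nonreal \<open>z\<close> the right-hand side vanishes exactly for \<open>m\<close>
  on the boundary of Weyl's disc, so points of the boundary can be found through conditions at
  \<open>d\<close>.\<close>

lemma wronskian_weyl_cnj: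
  assumes "d \<in> einterval a b" "c \<le> d"
  shows "wronskian (\<lambda>t. cnj (C z t + m * S z t)) (\<lambda>t. C z t + m * S z t) d =
    2 * \<i> * complex_of_real (Im m - Im z * weyl_norm z d m)"
proof -
  let ?u = "\<lambda>t. C z t + m * S z t"
  have "wronskian (\<lambda>t. cnj (?u t)) ?u c = m - cnj m"
    using vderiv_cnj[OF solution_weyl[unfolded solution_def] c, of z m] vderiv_weyl[OF c, of z m] C[of z] S[of z]
    by (simp add: wronskian_def)
  also have "\<dots> = 2 * \<i> * complex_of_real (Im m)" by (simp add: complex_eq_iff)
  finally show ?thesis
    using wronskian_norm[OF solution_weyl c assms, of z m] by (simp add: weyl_norm_def algebra_simps)
qed

text \<open>The solution with this \<open>m\<close> vanishes at \<open>d\<close>. Its \<open>m\<close> lies on the boundary of Weyl's disc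
  $\{m.\ \int_c^d |C + m S|^2 \le \mathrm{Im}\, m / \mathrm{Im}\, z\}$.\<close>

lemma weyl_norm_Dirichlet:
  assumes "Im z \<noteq> 0" "d \<in> einterval a b" "c < d"
  shows "weyl_norm z d (- C z d / S z d) = Im (- C z d / S z d) / Im z"
proof -
  let ?m = "- C z d / S z d"
  have u0: "C z d + ?m * S z d = 0" using S_nonzero[OF assms] by simp
  have "wronskian (\<lambda>t. cnj (C z t + ?m * S z t)) (\<lambda>t. C z t + ?m * S z t) d = 0"
    unfolding wronskian_def u0 by simp
  then have "Im ?m - Im z * weyl_norm z d ?m = 0"
    using wronskian_weyl_cnj[of d z ?m] assms(2,3) by (simp del: of_real_diff)
  then show ?thesis using assms(1) by (simp add: field_simps)
qed

text \<open>Expanding the square turns the integral with parameter into a polynomial in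
  \<open>m\<close> and \<open>cnj m\<close>, so no limit has to be taken under the integral.\<close>

lemma continuous_weyl_norm:
  assumes "d \<in> einterval a b"
  shows "continuous_on UNIV (weyl_norm z d)"
proof -
  note contCS = continuous_on_subset[OF continuous_on_C_S(1) einterval_Icc_subset[OF c assms], of z]
    continuous_on_subset[OF continuous_on_C_S(2) einterval_Icc_subset[OF c assms], of z]
  define I where "I f g = integral {c..d} (\<lambda>t. cnj (f t) * g t)" for f g :: "real \<Rightarrow> complex"
  have "weyl_norm z d m = Re (I (C z) (C z) + m * I (C z) (S z) + cnj m * I (S z) (C z) + cnj m * m * I (S z) (S z))" for m
  proof -
    have i: "(\<lambda>t. cnj (f t) * g t) integrable_on {c..d}"
      if "continuous_on {c..d} f" "continuous_on {c..d} g" for f g :: "real \<Rightarrow> complex"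
      using that by (intro integrable_continuous_real continuous_intros)
    have "complex_of_real (weyl_norm z d m) = integral {c..d} (\<lambda>t. cnj (C z t + m * S z t) * (C z t + m * S z t))"
      unfolding weyl_norm_def using contCS
      by (intro integral_cnj_mult_self[symmetric] integrable_continuous_real continuous_intros)
    also have "\<dots> = integral {c..d} (\<lambda>t. cnj (C z t) * C z t + m * (cnj (C z t) * S z t)
        + cnj m * (cnj (S z t) * C z t) + cnj m * m * (cnj (S z t) * S z t))"
      by (simp add: algebra_simps)
    also have "\<dots> = I (C z) (C z) + m * I (C z) (S z) + cnj m * I (S z) (C z) + cnj m * m * I (S z) (S z)"
      unfolding I_def
      by (simp only: Henstock_Kurzweil_Integration.integral_add integrable_add integrable_on_mult_right
          i contCS integral_mult_right)
    finally show ?thesis by (metis Re_complex_of_real)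
  qed
  then have "weyl_norm z d = (\<lambda>m. Re (I (C z) (C z) + m * I (C z) (S z) + cnj m * I (S z) (C z) + cnj m * m * I (S z) (S z)))"
    by (rule ext)
  then show ?thesis by (simp only:) (intro continuous_intros)
qed

lemma weyl_norm_mono:
  assumes "d \<in> einterval a b" "d' \<in> einterval a b" "d \<le> d'"
  shows "weyl_norm z d m \<le> weyl_norm z d' m"
  unfolding weyl_norm_def
  using continuous_on_subset[OF continuous_on_C_S(1) einterval_Icc_subset[OF c assms(2)], of z]
    continuous_on_subset[OF continuous_on_C_S(2) einterval_Icc_subset[OF c assms(2)], of z] assms(3)
  by (intro integral_subinterval_le continuous_intros) auto

text \<open>Boundedness: \<open>m * S z\<close> is the difference of \<open>C z + m * S z\<close>
  and \<open>C z\<close>, so \<open>A * (cmod m)\<^sup>2\<close> is bounded by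
  \<open>weyl_norm\<close> up to constants. In the disc the latter grows at most linearly in
  \<open>cmod m\<close>. Here \<open>A > 0\<close> is essential.\<close>

lemma compact_weyl_disc:
  assumes z: "Im z \<noteq> 0" and d: "d \<in> einterval a b" "c < d"
  shows "compact {m. weyl_norm z d m \<le> Im m / Im z}" (is "compact ?K")
proof -
  have cCS: "continuous_on {c..d} (C z)" "continuous_on {c..d} (S z)"
    using continuous_on_C_S einterval_Icc_subset[OF c d(1)] by (auto intro: continuous_on_subset)
  have "closed ?K"
    using z by (intro closed_Collect_le continuous_weyl_norm d continuous_intros) auto
  define A where "A = integral {c..d} (\<lambda>t. (cmod (S z t))\<^sup>2)"
  define D where "D = integral {c..d} (\<lambda>t. (cmod (C z t))\<^sup>2)"
  have A: "A > 0" unfolding A_def by (rule square_norm_S_pos[OF d])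
  have D: "D \<ge> 0" unfolding D_def
    by (intro Henstock_Kurzweil_Integration.integral_nonneg integrable_continuous_real continuous_intros cCS) auto
  have "cmod m \<le> (2 / \<bar>Im z\<bar> + 2 * D) / A + 1" if m: "m \<in> ?K" for m
  proof -
    have "A * (cmod m)\<^sup>2 = integral {c..d} (\<lambda>t. (cmod (m * S z t))\<^sup>2)"
      by (simp add: A_def norm_mult power_mult_distrib)
    also have "\<dots> \<le> integral {c..d} (\<lambda>t. 2 * (cmod (C z t + m * S z t))\<^sup>2 + 2 * (cmod (C z t))\<^sup>2)"
    proof (intro integral_le integrable_continuous_real continuous_intros cCS)
      show "(cmod (m * S z t))\<^sup>2 \<le> 2 * (cmod (C z t + m * S z t))\<^sup>2 + 2 * (cmod (C z t))\<^sup>2" for t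
        using cmod_add_square_le[of "C z t + m * S z t" "- C z t"] by simp
    qed
    also have "\<dots> = 2 * weyl_norm z d m + 2 * D"
      unfolding weyl_norm_def D_def
      by (subst Henstock_Kurzweil_Integration.integral_add)
        (auto intro!: integrable_continuous_real continuous_intros cCS)
    also have "\<dots> \<le> 2 * (cmod m / \<bar>Im z\<bar>) + 2 * D"
    proof -
      have "Im m / Im z \<le> \<bar>Im m / Im z\<bar>" by (rule abs_ge_self)
      also have "\<dots> = \<bar>Im m\<bar> / \<bar>Im z\<bar>" by (rule abs_divide)
      also have "\<dots> \<le> cmod m / \<bar>Im z\<bar>" by (intro divide_right_mono abs_Im_le_cmod) auto
      finally show ?thesis using m by simp
    qed
    finally show ?thesis using A D by (intro linear_bound_if_quadratic) auto
  qed
  then have "bounded ?K" unfolding bounded_iff by blast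
  with \<open>closed ?K\<close> show ?thesis by (simp add: compact_eq_bounded_closed)
qed

text \<open>The discs are nested since \<open>weyl_norm\<close> grows with the right end while
  \<open>Im m / Im z\<close> stays fixed, and each contains its Dirichlet value. A common point
  \<open>m\<close> bounds the norms on all compact intervals by \<open>Im m / Im z\<close>.\<close>

lemma ex_L2_weyl_solution:
  assumes z: "Im z \<noteq> 0"
  shows "\<exists>m. L2_near_right a b (\<lambda>x. C z x + m * S z x)"
proof -
  have cb: "ereal c < b" using c by (simp add: einterval_iff)
  obtain d l :: "nat \<Rightarrow> real" where d: "einterval (ereal c) b = (\<Union>i. {l i .. d i})" "incseq d" "decseq l"
    "\<And>i. l i < d i" "\<And>i. ereal c < ereal (l i)" "\<And>i. ereal (d i) < b"
    by (rule einterval_Icc_approximation[OF cb]) blast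
  have cd: "c < d i" for i using d(4,5)[of i] by auto
  have dE: "d i \<in> einterval a b" for i
    using einterval_right_subset[OF c] d(6)[of i] cd[of i] by (auto simp: einterval_iff)
  have "\<Inter> (range (\<lambda>i. {m. weyl_norm z (d i) m \<le> Im m / Im z})) \<noteq> {}"
  proof (rule compact_nest)
    show "compact {m. weyl_norm z (d i) m \<le> Im m / Im z}" for i
      by (rule compact_weyl_disc[OF z dE cd])
    show "{m. weyl_norm z (d i) m \<le> Im m / Im z} \<noteq> {}" for i
      using weyl_norm_Dirichlet[OF z dE cd, of i] by (metis (mono_tags, lifting) empty_iff mem_Collect_eq order_refl)
    show "{m. weyl_norm z (d j) m \<le> Im m / Im z} \<subseteq> {m. weyl_norm z (d i) m \<le> Im m / Im z}" if "i \<le> j" for i j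
      using weyl_norm_mono[OF dE[of i] dE[of j] incseqD[OF d(2) that]] order_trans by blast
  qed
  then obtain m where m: "\<And>i. weyl_norm z (d i) m \<le> Im m / Im z" by auto
  let ?u = "\<lambda>x. C z x + m * S z x"
  have contu: "continuous_on (einterval a b) ?u" by (intro continuous_intros continuous_on_C_S)
  have "(\<lambda>x. (cmod (?u x))\<^sup>2) absolutely_integrable_on einterval (ereal c) b"
  proof (rule absolutely_integrable_if_bounded[OF _ c])
    show "loc_integrable a b (\<lambda>x. (cmod (?u x))\<^sup>2)"
      by (intro loc_integrable_continuous continuous_intros contu)
    fix x assume x: "x \<in> einterval a b" "c < x"
    then have "x \<in> einterval (ereal c) b" by (simp add: einterval_iff)
    then obtain i where "x \<le> d i" using d(1) by auto
    then have "weyl_norm z x m \<le> Im m / Im z"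
      using weyl_norm_mono[OF x(1) dE[of i], of z m] m[of i] by linarith
    then show "integral {c..x} (\<lambda>x. (cmod (?u x))\<^sup>2) \<le> Im m / Im z"
      by (simp add: weyl_norm_def)
  qed auto
  moreover have "continuous_on (einterval (ereal c) b) ?u"
    using contu einterval_right_subset[OF c] by (rule continuous_on_subset)
  ultimately have "?u \<in> L2 (ereal c) b" by (simp add: L2_continuous_iff)
  then show ?thesis using c by (auto simp: L2_near_right_def)
qed

text \<open>Otherwise \<open>S z\<close> would be a Dirichlet eigenfunction on \<open>(c,b)\<close>
  for a nonreal \<open>z\<close>. Green's identity for \<open>S z\<close> with itself has right-hand
  side zero because \<open>S z\<close> vanishes at \<open>c\<close>.\<close>

lemma S_not_in_domain:
  assumes H: "self_adjoint a b (H_op a b q v w)" and z: "Im z \<noteq> 0"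
  shows "\<not> in_domain_near_right a b q w (S z)"
proof
  assume dom: "in_domain_near_right a b q w (S z)"
  have sol: "solution a b q z (S z)" using S by blast
  have "wronskian (\<lambda>x. cnj (S z x)) (S z) c = 0"
    using S[of z] vderiv_cnj[OF sol[unfolded solution_def] c] by (simp add: wronskian_def)
  then have "(z - cnj z) * integral (einterval (ereal c) b) (\<lambda>x. cnj (S z x) * S z x) = 0"
    using green_identity_right[OF H c sol dom sol dom] by simp
  moreover have "z - cnj z \<noteq> 0" using z by (simp add: complex_eq_iff)
  ultimately have 0: "integral (einterval (ereal c) b) (\<lambda>x. cnj (S z x) * S z x) = 0" by simp
  have cont: "continuous_on (einterval (ereal c) b) (S z)"
    using continuous_on_C_S(2) einterval_right_subset[OF c] by (rule continuous_on_subset)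
  have "S z \<in> L2 (ereal c) b"
    using dom c continuous_on_C_S(2) by (auto simp: in_domain_near_right_def intro: L2_right)
  then have S0: "S z x = 0" if "x \<in> einterval (ereal c) b" for x
    using zero_if_integral_norm_square_zero[OF _ cont 0 that] by blast
  obtain d where "d \<in> einterval (ereal c) b"
    using einterval_nonempty[of "ereal c" b] c by (auto simp: einterval_iff)
  then have d: "c < d" "d \<in> einterval a b" using einterval_right_subset[OF c] by (auto simp: einterval_iff)
  with S_not_identically_zero obtain x where x: "x \<in> {c<..<d}" "S z x \<noteq> 0" by blast
  then have "x \<in> einterval a b" using einterval_Icc_subset[OF c d(2)] by auto
  then have "x \<in> einterval (ereal c) b" using x(1) by (simp add: einterval_iff)
  with S0 x(2) show False by blast
qed

text \<open>In the limit circle case every combination is square integrable, and the boundary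
  condition is the single linear equation \<open>LC + m * LS = 0\<close>. It is solvable because
  \<open>LS = 0\<close> would put \<open>S z\<close> into the domain near \<open>b\<close>.\<close>

lemma ex_weyl_m:
  assumes H: "self_adjoint a b (H_op a b q v w)" and w: "bc_function_right a b q w" and z: "Im z \<noteq> 0"
  shows "\<exists>m. in_domain_near_right a b q w (\<lambda>x. C z x + m * S z x)"
proof (cases "limit_circle_right a b q")
  case False
  then show ?thesis using ex_L2_weyl_solution[OF z] by (auto simp: in_domain_near_right_def bc_right_def)
next
  case True
  then obtain g where wL: "w \<in> L2 a b" "g \<in> L2 a b" "tau_eq a b q w g"
    using w by (auto simp: bc_function_right_def max_domain_def)
  then have wR: "w \<in> L2 (ereal c) b" "g \<in> L2 (ereal c) b"
    using L2_subset einterval_right_subset[OF c] by blast+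
  have lim: "\<exists>L. ((\<lambda>x. wronskian w f (real_of_ereal x)) \<longlongrightarrow> L) (at_left b)" if f: "solution a b q z f" for f
  proof -
    have "f \<in> L2 (ereal c) b"
      using weyl_alternative[OF True f] tau_eq_continuous(1)[OF f[unfolded solution_def]] c by (rule L2_right)
    then show ?thesis
      by (intro wronskian_tendsto_right[OF wL(3) f[unfolded solution_def] c] wR L2_cmult)
  qed
  obtain LC LS where LC: "((\<lambda>x. wronskian w (C z) (real_of_ereal x)) \<longlongrightarrow> LC) (at_left b)"
    and LS: "((\<lambda>x. wronskian w (S z) (real_of_ereal x)) \<longlongrightarrow> LS) (at_left b)"
    using lim[of "C z"] lim[of "S z"] C[of z] S[of z] by blast
  have "LS \<noteq> 0"
  proof
    assume "LS = 0"
    then have "in_domain_near_right a b q w (S z)"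
      using LS weyl_alternative[OF True] S[of z]
      by (auto simp: in_domain_near_right_def bc_right_def wronskian_zero_right_def)
    then show False using S_not_in_domain[OF H z] by blast
  qed
  define m where "m = - LC / LS"
  have "((\<lambda>x. wronskian w (C z) (real_of_ereal x) + m * wronskian w (S z) (real_of_ereal x)) \<longlongrightarrow> LC + m * LS) (at_left b)"
    by (intro tendsto_intros LC LS)
  moreover have "LC + m * LS = 0" using \<open>LS \<noteq> 0\<close> by (simp add: m_def)
  moreover have "eventually (\<lambda>x. wronskian w (C z) (real_of_ereal x) + m * wronskian w (S z) (real_of_ereal x)
      = wronskian w (\<lambda>x. C z x + m * S z x) (real_of_ereal x)) (at_left b)"
    by (rule eventually_at_left_ereal[OF c]) (simp add: wronskian_def vderiv_weyl algebra_simps)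
  ultimately have "wronskian_zero_right b w (\<lambda>x. C z x + m * S z x)"
    unfolding wronskian_zero_right_def using Lim_transform_eventually by fastforce
  then show ?thesis
    using weyl_alternative[OF True solution_weyl] by (auto simp: in_domain_near_right_def bc_right_def)
qed

end

section \<open>The singular Weyl function\<close>

text \<open>Schwarz reflection: \<open>F\<close> and its reflection are entire and agree on the
  reals, which accumulate at 0, so the identity theorem applies.\<close>

lemma real_entire_cnj:
  assumes "real_entire F"
  shows "F (cnj z) = cnj (F z)"
proof -
  have hol: "F holomorphic_on UNIV" and real: "\<And>z. z \<in> \<real> \<Longrightarrow> F z \<in> \<real>"
    using assms by (auto simp: real_entire_def)
  have "(cnj \<circ> F \<circ> cnj) holomorphic_on UNIV"
    using hol by (intro holomorphic_on_compose_cnj_cnj) auto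
  then have "(\<lambda>w. cnj (F (cnj w))) holomorphic_on UNIV"
    by (simp add: o_def)
  with hol have diff: "(\<lambda>w. F w - cnj (F (cnj w))) holomorphic_on UNIV"
    by (rule holomorphic_on_diff)
  have lim: "(0::complex) islimpt \<real>"
    unfolding islimpt_approachable
  proof (intro allI impI)
    fix e :: real assume "e > 0"
    then show "\<exists>y\<in>\<real>. y \<noteq> 0 \<and> dist y (0::complex) < e"
      by (intro bexI[of _ "complex_of_real (e / 2)"]) auto
  qed
  have "F (cnj z) - cnj (F (cnj (cnj z))) = 0"
  proof (rule analytic_continuation[OF diff open_UNIV connected_UNIV subset_UNIV UNIV_I lim])
    show "F w - cnj (F (cnj w)) = 0" if "w \<in> \<real>" for w
      using real[OF that] that by (simp add: Reals_cnj_iff)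
  qed auto
  then show ?thesis by simp
qed

text \<open>Continuity of \<open>m\<close> comes first: the case \<open>z = \<zeta>\<close> bounds the norm of \<open>U z\<close> by \<open>m z\<close>, which makes
  \<open>m\<close> locally Lipschitz. By polarization \<open>U\<close> is then continuous in $L^2$, so that the difference
  quotients of \<open>m\<close>, which are inner products, converge.\<close>

lemma differentiable_if_Green_identity:
  fixes m :: "complex \<Rightarrow> complex" and U :: "complex \<Rightarrow> real \<Rightarrow> complex"
  assumes L2: "\<And>z. Im z \<noteq> 0 \<Longrightarrow> U z \<in> L2 a b"
    and green: "\<And>z \<zeta>. Im z \<noteq> 0 \<Longrightarrow> Im \<zeta> \<noteq> 0 \<Longrightarrow>
      (\<zeta> - cnj z) * integral (einterval a b) (\<lambda>x. cnj (U z x) * U \<zeta> x) = m \<zeta> - cnj (m z)"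
    and \<zeta>: "Im \<zeta> \<noteq> 0"
  shows "m field_differentiable at \<zeta>"
proof -
  define I where "I f g = integral (einterval a b) (\<lambda>x. cnj (f x) * g x)" for f g :: "real \<Rightarrow> complex"
  define nrm where "nrm f = integral (einterval a b) (\<lambda>x. (cmod (f x))\<^sup>2)" for f :: "real \<Rightarrow> complex"
  have nrm: "I f f = complex_of_real (nrm f)" "nrm f \<ge> 0" if "f \<in> L2 a b" for f
  proof -
    have "(\<lambda>x. (cmod (f x))\<^sup>2) integrable_on einterval a b"
      using that by (auto simp: L2_iff set_lebesgue_integral_eq_integral(1))
    then show "I f f = complex_of_real (nrm f)" "nrm f \<ge> 0"
      by (auto simp: I_def nrm_def integral_cnj_mult_self intro!: Henstock_Kurzweil_Integration.integral_nonneg)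
  qed
  have CS: "(cmod (I f g))\<^sup>2 \<le> nrm f * nrm g" if "f \<in> L2 a b" "g \<in> L2 a b" for f g
    using L2_Cauchy_Schwarz[OF L2_cnj[OF that(1)] that(2)] by (simp add: I_def nrm_def)
  have int: "(\<lambda>x. cnj (f x) * g x) integrable_on einterval a b" if "f \<in> L2 a b" "g \<in> L2 a b" for f g
    using that by (intro set_lebesgue_integral_eq_integral(1) L2_mult L2_cnj)
  have G: "(w - cnj z) * I (U z) (U w) = m w - cnj (m z)" if "Im z \<noteq> 0" "Im w \<noteq> 0" for z w
    using green[OF that] by (simp add: I_def)
  \<comment> \<open>For \<open>w = cnj z\<close> the factor in front of the inner product
    vanishes.\<close>
  have sym: "m (cnj z) = cnj (m z)" if "Im z \<noteq> 0" for z
    using G[of z "cnj z"] that by simp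
  \<comment> \<open>With the conjugate point in the first slot, Green's identity becomes an exact
    formula for the increment \<open>m z - m \<zeta>\<close>, whose quotient by
    \<open>z - \<zeta>\<close> is a single inner product.\<close>
  define \<zeta>' where "\<zeta>' = cnj \<zeta>"
  have \<zeta>': "Im \<zeta>' \<noteq> 0" using \<zeta> by (simp add: \<zeta>'_def)
  have diff: "m z - m \<zeta> = (z - \<zeta>) * I (U \<zeta>') (U z)" if "Im z \<noteq> 0" for z
    using G[OF \<zeta>' that] sym[OF \<zeta>] by (simp add: \<zeta>'_def)
  have near: "eventually (\<lambda>z. \<bar>Im z\<bar> > \<bar>Im \<zeta>\<bar> / 2) (at \<zeta>)"
  proof (rule order_tendstoD(1))
    show "((\<lambda>z. \<bar>Im z\<bar>) \<longlongrightarrow> \<bar>Im \<zeta>\<bar>) (at \<zeta>)" by (intro tendsto_intros)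
    show "\<bar>Im \<zeta>\<bar> / 2 < \<bar>Im \<zeta>\<bar>" using \<zeta> by simp
  qed
  have nonreal: "eventually (\<lambda>z. Im z \<noteq> 0) (at \<zeta>)"
    using near by eventually_elim auto
  have m_lim: "(m \<longlongrightarrow> m \<zeta>) (at \<zeta>)"
  proof -
    define \<eta> where "\<eta> = \<bar>Im \<zeta>\<bar> / 2"
    \<comment> \<open>The future Lipschitz constant: \<open>K + D / \<eta>\<close> bounds
      \<open>nrm (U \<zeta>') + nrm (U z)\<close>, where \<open>D\<close> is the modulus of the
      increment of \<open>m\<close>.\<close>
    define K where "K = nrm (U \<zeta>') + cmod (m \<zeta>) / \<eta>"
    have \<eta>: "\<eta> > 0" using \<zeta> by (simp add: \<eta>_def)
    have "eventually (\<lambda>z. dist z \<zeta> < \<eta>) (at \<zeta>)"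
      using eventually_at_ball[OF \<eta>, of \<zeta> UNIV] by (simp add: ball_def dist_commute)
    then have "eventually (\<lambda>z. norm (m z - m \<zeta>) \<le> dist z \<zeta> * K) (at \<zeta>)"
      using near
    proof eventually_elim
      case (elim z)
      then have z: "Im z \<noteq> 0" "\<bar>Im z\<bar> \<ge> \<eta>" by (auto simp: \<eta>_def)
      define D where "D = cmod (m z - m \<zeta>)"
      have "2 * \<i> * complex_of_real (Im z * nrm (U z)) = 2 * \<i> * complex_of_real (Im (m z))"
        using G[OF z(1) z(1)] nrm(1)[OF L2[OF z(1)]] by (simp add: complex_eq_iff)
      then have "Im z * nrm (U z) = Im (m z)"
        by (metis (no_types, lifting) complex_i_not_zero mult_cancel_left mult_eq_0_iff of_real_eq_iff zero_neq_numeral)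
      then have "\<bar>Im z\<bar> * nrm (U z) = \<bar>Im (m z)\<bar>"
        using nrm(2)[OF L2[OF z(1)]] by (metis abs_mult abs_of_nonneg)
      then have "\<eta> * nrm (U z) \<le> cmod (m z)"
        using mult_right_mono[OF z(2) nrm(2)[OF L2[OF z(1)]]] abs_Im_le_cmod[of "m z"] by linarith
      also have "\<dots> \<le> cmod (m \<zeta>) + D"
        unfolding D_def using norm_triangle_sub by blast
      finally have n: "nrm (U z) \<le> (cmod (m \<zeta>) + D) / \<eta>" using \<eta> by (simp add: pos_le_divide_eq mult.commute)
      \<comment> \<open>Cauchy-Schwarz followed by the inequality of the means: the bound becomes
        linear in \<open>nrm (U z)\<close>, and the factor one half makes the absorption of
        \<open>D\<close> possible.\<close>
      have "(cmod (I (U \<zeta>') (U z)))\<^sup>2 \<le> ((nrm (U \<zeta>') + nrm (U z)) / 2)\<^sup>2"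
        using CS[OF L2[OF \<zeta>'] L2[OF z(1)]] zero_le_power2[of "nrm (U \<zeta>') - nrm (U z)"]
        by (simp add: power2_eq_square field_simps)
      moreover have "0 \<le> (nrm (U \<zeta>') + nrm (U z)) / 2"
        using nrm(2)[OF L2[OF \<zeta>']] nrm(2)[OF L2[OF z(1)]] by simp
      ultimately have "cmod (I (U \<zeta>') (U z)) \<le> (nrm (U \<zeta>') + nrm (U z)) / 2"
        by (rule power2_le_imp_le)
      also have "\<dots> \<le> (K + D / \<eta>) / 2" using n by (simp add: K_def add_divide_distrib)
      finally have "dist z \<zeta> * cmod (I (U \<zeta>') (U z)) \<le> dist z \<zeta> * ((K + D / \<eta>) / 2)"
        by (intro mult_left_mono) auto
      then have "D \<le> dist z \<zeta> * ((K + D / \<eta>) / 2)"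
        unfolding D_def diff[OF z(1)] by (simp add: norm_mult dist_norm)
      also have "\<dots> = (dist z \<zeta> * K) / 2 + (dist z \<zeta> * (D / \<eta>)) / 2" by (simp add: algebra_simps add_divide_distrib)
      \<comment> \<open>Since \<open>dist z \<zeta>\<close> is less than \<open>\<eta>\<close>, only
        half of \<open>D\<close> is left on the right and can be absorbed.\<close>
      also have "dist z \<zeta> * (D / \<eta>) \<le> \<eta> * (D / \<eta>)"
        using elim(1) \<eta> by (intro mult_right_mono) (auto simp: \<eta>_def D_def)
      also have "\<eta> * (D / \<eta>) = D" using \<eta> by simp
      finally show ?case by (simp add: D_def)
    qed
    moreover have "((\<lambda>z. dist z \<zeta> * K) \<longlongrightarrow> dist \<zeta> \<zeta> * K) (at \<zeta>)" by (intro tendsto_intros)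
    ultimately have "((\<lambda>z. m z - m \<zeta>) \<longlongrightarrow> 0) (at \<zeta>)"
      by (intro Lim_null_comparison[of "\<lambda>z. m z - m \<zeta>" "\<lambda>z. dist z \<zeta> * K"]) simp_all
    then show ?thesis by (simp add: LIM_zero_iff)
  qed
  define E where "E z = nrm (\<lambda>x. U z x - U \<zeta> x)" for z
  \<comment> \<open>\<open>Q\<close> expresses inner products through \<open>m\<close>, so that
    continuity of \<open>m\<close> passes to them. Its denominator vanishes for
    \<open>w = cnj z\<close>, hence the exclusions below.\<close>
  define Q where "Q z w = (m w - cnj (m z)) / (w - cnj z)" for z w
  have IQ: "I (U z) (U w) = Q z w" if "Im z \<noteq> 0" "Im w \<noteq> 0" "w \<noteq> cnj z" for z w
    using G[OF that(1,2)] that(3) by (simp add: Q_def field_simps)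
  have ne: "\<zeta> \<noteq> cnj \<zeta>" using \<zeta> by (simp add: complex_eq_iff)
  have sub: "(\<lambda>x. U z x - U \<zeta> x) \<in> L2 a b" if "Im z \<noteq> 0" for z
    using L2_lincomb[OF L2[OF that] L2[OF \<zeta>], of 1 "-1"] by simp
  have "eventually (\<lambda>z. z \<noteq> cnj \<zeta>) (at \<zeta>)" 
    by (rule tendsto_imp_eventually_ne[OF tendsto_ident_at ne])
  with nonreal have E_eq: "eventually (\<lambda>z. complex_of_real (E z) = Q z z - Q z \<zeta> - Q \<zeta> z + Q \<zeta> \<zeta>) (at \<zeta>)"
  proof eventually_elim
    case (elim z)
    note Lz = L2[OF elim(1)] L2[OF \<zeta>]
    have "complex_of_real (E z) = I (\<lambda>x. U z x - U \<zeta> x) (\<lambda>x. U z x - U \<zeta> x)"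
      using nrm(1)[OF sub[OF elim(1)]] by (simp add: E_def)
    also have "\<dots> = integral (einterval a b) (\<lambda>x. (cnj (U z x) * U z x - cnj (U z x) * U \<zeta> x)
        - cnj (U \<zeta> x) * U z x + cnj (U \<zeta> x) * U \<zeta> x)"
      by (simp add: I_def algebra_simps)
    also have "\<dots> = I (U z) (U z) - I (U z) (U \<zeta>) - I (U \<zeta>) (U z) + I (U \<zeta>) (U \<zeta>)"
      unfolding I_def
      by (simp only: Henstock_Kurzweil_Integration.integral_add Henstock_Kurzweil_Integration.integral_diff
          integrable_add integrable_diff int Lz)
    also have "\<dots> = Q z z - Q z \<zeta> - Q \<zeta> z + Q \<zeta> \<zeta>"
    proof -
      have "z \<noteq> cnj z" using elim(1) by (simp add: complex_eq_iff)
      moreover have "\<zeta> \<noteq> cnj z" using elim(2) by (metis complex_cnj_cnj)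
      ultimately show ?thesis using IQ elim \<zeta> ne by simp
    qed
    finally show ?case .
  qed
  \<comment> \<open>All four terms have the limit \<open>Q \<zeta> \<zeta>\<close>, so they cancel,
    and \<open>U z\<close> tends to \<open>U \<zeta>\<close> in norm.\<close>
  have "((\<lambda>z. Q z z - Q z \<zeta> - Q \<zeta> z + Q \<zeta> \<zeta>) \<longlongrightarrow> Q \<zeta> \<zeta> - Q \<zeta> \<zeta> - Q \<zeta> \<zeta> + Q \<zeta> \<zeta>) (at \<zeta>)"
    unfolding Q_def using ne by (intro tendsto_intros m_lim) auto
  then have "((\<lambda>z. complex_of_real (E z)) \<longlongrightarrow> 0) (at \<zeta>)"
    using Lim_transform_eventually[OF _ eventually_mono[OF E_eq]] by fastforce
  then have E_lim: "(E \<longlongrightarrow> 0) (at \<zeta>)"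
    using tendsto_of_real_iff[of E 0 "at \<zeta>"] by (metis of_real_0)
  have "((\<lambda>z. I (U \<zeta>') (U z) - I (U \<zeta>') (U \<zeta>)) \<longlongrightarrow> 0) (at \<zeta>)"
  proof (rule Lim_null_comparison)
    show "eventually (\<lambda>z. norm (I (U \<zeta>') (U z) - I (U \<zeta>') (U \<zeta>)) \<le> sqrt (nrm (U \<zeta>') * E z)) (at \<zeta>)"
      using nonreal
    proof eventually_elim
      case (elim z)
      have "I (U \<zeta>') (U z) - I (U \<zeta>') (U \<zeta>) = I (U \<zeta>') (\<lambda>x. U z x - U \<zeta> x)"
        unfolding I_def using int L2 elim \<zeta> \<zeta>'
        by (subst Henstock_Kurzweil_Integration.integral_diff[symmetric]) (auto simp: algebra_simps)
      then show ?case
        using CS[OF L2[OF \<zeta>'] sub[OF elim]] by (simp add: E_def real_le_rsqrt)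
    qed
    have "((\<lambda>z. sqrt (nrm (U \<zeta>') * E z)) \<longlongrightarrow> sqrt (nrm (U \<zeta>') * 0)) (at \<zeta>)"
      by (intro tendsto_intros E_lim)
    then show "((\<lambda>z. sqrt (nrm (U \<zeta>') * E z)) \<longlongrightarrow> 0) (at \<zeta>)" by simp
  qed
  then have "((\<lambda>z. I (U \<zeta>') (U z)) \<longlongrightarrow> I (U \<zeta>') (U \<zeta>)) (at \<zeta>)"
    by (simp add: LIM_zero_iff)
  moreover have "eventually (\<lambda>z. I (U \<zeta>') (U z) = (m z - m \<zeta>) / (z - \<zeta>)) (at \<zeta>)"
    using nonreal eventually_neq_at_within[of \<zeta> \<zeta> UNIV]
  proof eventually_elim
    case (elim z)
    then show ?case using diff[OF elim(1)] by simp
  qed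
  ultimately have "((\<lambda>z. (m z - m \<zeta>) / (z - \<zeta>)) \<longlongrightarrow> I (U \<zeta>') (U \<zeta>)) (at \<zeta>)"
    by (rule Lim_transform_eventually)
  then show ?thesis
    unfolding field_differentiable_def has_field_derivative_iff by blast
qed

section \<open>Domain conditions near b and reality of eigenvalues\<close>

lemma vderiv_cong:
  assumes "\<And>x. x \<in> einterval a b \<Longrightarrow> f x = g x" and "x \<in> einterval a b"
  shows "vderiv f x = vderiv g x"
proof -
  have "eventually (\<lambda>y. f y = g y) (nhds x)"
    using assms eventually_nhds_in_open[OF open_einterval assms(2)] by (auto elim: eventually_mono)
  then show ?thesis by (intro vector_derivative_cong_eq) auto
qed

text \<open>Functions live on the whole real line with arbitrary values outside
  \<open>(a,b)\<close>; solutions can be identified only inside the interval, and the condition near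
  \<open>b\<close> must respect this.\<close>

lemma in_domain_near_right_cong:
  assumes eq: "\<And>x. x \<in> einterval a b \<Longrightarrow> f x = g x" and c: "c \<in> einterval a b"
    and f: "in_domain_near_right a b q w f"
  shows "in_domain_near_right a b q w g"
proof -
  obtain d where d: "d \<in> einterval a b" "f \<in> L2 (ereal d) b"
    using f by (auto simp: in_domain_near_right_def L2_near_right_def)
  have eq': "f x = g x" if "x \<in> einterval (ereal d) b" for x
    using einterval_right_subset[OF d(1)] that eq by blast
  have "g \<in> borel_measurable (lebesgue_on (einterval (ereal d) b))"
    using d(2) measurable_cong[of "lebesgue_on (einterval (ereal d) b)" f g borel] eq'
    by (simp add: L2_iff)
  moreover have "(\<lambda>x. (cmod (g x))\<^sup>2) absolutely_integrable_on einterval (ereal d) b"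
    using d(2) set_integrable_cong[of lebesgue lebesgue "einterval (ereal d) b" "einterval (ereal d) b"
        "\<lambda>x. (cmod (f x))\<^sup>2" "\<lambda>x. (cmod (g x))\<^sup>2"] eq'
    by (simp add: L2_iff)
  ultimately have "L2_near_right a b g" using d(1) by (auto simp: L2_near_right_def L2_iff)
  moreover have "bc_right a b q w g"
    unfolding bc_right_def wronskian_zero_right_def
  proof
    assume "limit_circle_right a b q"
    then have "((\<lambda>x. wronskian w f (real_of_ereal x)) \<longlongrightarrow> 0) (at_left b)"
      using f by (simp add: in_domain_near_right_def bc_right_def wronskian_zero_right_def)
    moreover have "eventually (\<lambda>x. wronskian w f (real_of_ereal x) = wronskian w g (real_of_ereal x)) (at_left b)"
      by (rule eventually_at_left_ereal[OF c]) (simp add: wronskian_def eq vderiv_cong[of a b f g])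
    ultimately show "((\<lambda>x. wronskian w g (real_of_ereal x)) \<longlongrightarrow> 0) (at_left b)"
      by (rule Lim_transform_eventually)
  qed
  ultimately show ?thesis by (simp add: in_domain_near_right_def)
qed

lemma in_domain_near_right_lincomb:
  assumes f: "solution a b q z f" "in_domain_near_right a b q w f"
    and g: "solution a b q z g" "in_domain_near_right a b q w g" and c: "c \<in> einterval a b"
  shows "in_domain_near_right a b q w (\<lambda>x. \<alpha> * f x + \<beta> * g x)"
proof -
  have "f \<in> L2 (ereal c) b" "g \<in> L2 (ereal c) b"
    using f g c by (auto simp: in_domain_near_right_def solution_def intro: L2_right tau_eq_continuous)
  then have "(\<lambda>x. \<alpha> * f x + \<beta> * g x) \<in> L2 (ereal c) b" by (rule L2_lincomb)
  then have "L2_near_right a b (\<lambda>x. \<alpha> * f x + \<beta> * g x)"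
    using c by (auto simp: L2_near_right_def)
  moreover have "bc_right a b q w (\<lambda>x. \<alpha> * f x + \<beta> * g x)"
    unfolding bc_right_def wronskian_zero_right_def
  proof
    assume "limit_circle_right a b q"
    then have "((\<lambda>x. \<alpha> * wronskian w f (real_of_ereal x) + \<beta> * wronskian w g (real_of_ereal x)) \<longlongrightarrow> \<alpha> * 0 + \<beta> * 0) (at_left b)"
      using f(2) g(2) by (intro tendsto_intros) (auto simp: in_domain_near_right_def bc_right_def wronskian_zero_right_def)
    then have "((\<lambda>x. \<alpha> * wronskian w f (real_of_ereal x) + \<beta> * wronskian w g (real_of_ereal x)) \<longlongrightarrow> 0) (at_left b)"
      by simp
    moreover have "eventually (\<lambda>x. \<alpha> * wronskian w f (real_of_ereal x) + \<beta> * wronskian w g (real_of_ereal x) =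
        wronskian w (\<lambda>x. \<alpha> * f x + \<beta> * g x) (real_of_ereal x)) (at_left b)"
      by (rule eventually_at_left_ereal[OF c]) (simp add: wronskian_def vderiv_lincomb[OF f(1) g(1)] algebra_simps)
    ultimately show "((\<lambda>x. wronskian w (\<lambda>x. \<alpha> * f x + \<beta> * g x) (real_of_ereal x)) \<longlongrightarrow> 0) (at_left b)"
      by (rule Lim_transform_eventually)
  qed
  ultimately show ?thesis by (simp add: in_domain_near_right_def)
qed

text \<open>The conditions at both ends put \<open>f\<close> into the domain of \<open>H\<close>,
  and a symmetric operator has no nonreal eigenvalues.\<close>

lemma eigenfunction_zero:
  assumes H: "self_adjoint a b (H_op a b q v w)" and z: "Im z \<noteq> 0" and f: "solution a b q z f"
    and left: "in_domain_near_left a b q v f" and right: "in_domain_near_right a b q w f"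
    and x: "x \<in> einterval a b"
  shows "f x = 0"
proof -
  have cont: "continuous_on (einterval a b) f" using f by (auto simp: solution_def intro: tau_eq_continuous)
  obtain d where d: "d \<in> einterval a b" "f \<in> L2 a (ereal d)"
    using left by (auto simp: in_domain_near_left_def L2_near_left_def)
  have R: "f \<in> L2 (ereal x) b"
    using right cont x by (auto simp: in_domain_near_right_def intro: L2_right)
  have "(\<lambda>x. (cmod (f x))\<^sup>2) absolutely_integrable_on einterval a b"
  proof (rule absolutely_integrable_einterval_Un[OF _ _ _ d(1) x])
    show "loc_integrable a b (\<lambda>x. (cmod (f x))\<^sup>2)"
      by (intro loc_integrable_continuous continuous_intros cont)
  qed (use d(2) R in \<open>auto simp: L2_iff\<close>)
  then have L2: "f \<in> L2 a b" by (simp add: L2_continuous_iff[OF cont])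
  have "(f, \<lambda>x. z * f x) \<in> H_op a b q v w"
    using f left right
    by (intro H_op_memberI L2 L2_cmult) (auto simp: solution_def in_domain_near_left_def in_domain_near_right_def)
  then have "L2_inner a b f (\<lambda>x. z * f x) = L2_inner a b (\<lambda>x. z * f x) f"
    using self_adjoint_symmetric[OF H] by blast
  then have "integral (einterval a b) (\<lambda>x. z * (cnj (f x) * f x)) = integral (einterval a b) (\<lambda>x. cnj z * (cnj (f x) * f x))"
    using L2 L2_cmult[OF L2, of z] by (simp add: L2_inner_eq algebra_simps)
  then have "(z - cnj z) * integral (einterval a b) (\<lambda>x. cnj (f x) * f x) = 0"
    by (simp add: algebra_simps)
  moreover have "z - cnj z \<noteq> 0" using z by (simp add: complex_eq_iff)
  ultimately have "integral (einterval a b) (\<lambda>x. cnj (f x) * f x) = 0" by simp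
  then show ?thesis using zero_if_integral_norm_square_zero[OF L2 cont _ x] by blast
qed

section \<open>The Weyl m-function at nonreal points\<close>

locale weyl_setup = fundamental_system +
  fixes v w
  assumes H: "self_adjoint a b (H_op a b q v w)" and w: "bc_function_right a b q w"
begin

abbreviation "m \<equiv> weyl_m a b q w C S"
abbreviation "U \<equiv> weyl_solution a b q w C S"

text \<open>The difference of two candidates is a nonzero multiple of \<open>S z\<close>, which
  violates the condition near \<open>b\<close>.\<close>

lemma weyl_m_unique:
  assumes z: "Im z \<noteq> 0"
    and m1: "in_domain_near_right a b q w (\<lambda>x. C z x + m1 * S z x)"
    and m2: "in_domain_near_right a b q w (\<lambda>x. C z x + m2 * S z x)"
  shows "m1 = m2"
proof (rule ccontr)
  assume "m1 \<noteq> m2"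
  let ?k = "1 / (m1 - m2)"
  have "in_domain_near_right a b q w (\<lambda>x. ?k * (C z x + m1 * S z x) + (- ?k) * (C z x + m2 * S z x))"
    by (rule in_domain_near_right_lincomb[OF solution_weyl m1 solution_weyl m2 c])
  moreover have "?k * (C z x + m1 * S z x) + (- ?k) * (C z x + m2 * S z x) = S z x" for x
    using \<open>m1 \<noteq> m2\<close> by (simp add: divide_simps) (simp add: algebra_simps)
  ultimately have "in_domain_near_right a b q w (S z)" by simp
  then show False using S_not_in_domain[OF H z] by blast
qed

text \<open>Existence and uniqueness together make the definite description in \<open>weyl_m\<close>
  denote the intended value.\<close>

lemma weyl_solution_in_domain:
  assumes "Im z \<noteq> 0"
  shows "in_domain_near_right a b q w (U z)"
proof -
  have "\<exists>!m. in_domain_near_right a b q w (\<lambda>x. C z x + m * S z x)"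
    using ex_weyl_m[OF H w assms] weyl_m_unique[OF assms] by blast
  from theI'[OF this] show ?thesis
    by (simp add: weyl_solution_def[abs_def] weyl_m_def)
qed

lemma weyl_solution_solution: "solution a b q z (U z)"
  using solution_weyl[of z "m z"] by (simp add: weyl_solution_def[abs_def])

lemma weyl_solution_at_c: "U z c = 1" "vderiv (U z) c = m z"
  using vderiv_weyl[OF c, of z "m z"] C[of z] S[of z] by (simp_all add: weyl_solution_def[abs_def])

lemma weyl_green:
  assumes "Im z \<noteq> 0" "Im \<zeta> \<noteq> 0"
  shows "(\<zeta> - cnj z) * integral (einterval (ereal c) b) (\<lambda>x. cnj (U z x) * U \<zeta> x) = m \<zeta> - cnj (m z)"
  using green_identity_right[OF H c weyl_solution_solution weyl_solution_in_domain[OF assms(1)]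
      weyl_solution_solution weyl_solution_in_domain[OF assms(2)]]
    vderiv_cnj[OF weyl_solution_solution[unfolded solution_def] c, of z]
  by (simp add: wronskian_def weyl_solution_at_c)

lemma weyl_m_cnj: "Im z \<noteq> 0 \<Longrightarrow> m (cnj z) = cnj (m z)"
  using weyl_green[of z "cnj z"] by simp

lemma weyl_m_differentiable:
  assumes "Im z \<noteq> 0"
  shows "m field_differentiable at z"
proof (rule differentiable_if_Green_identity[OF _ weyl_green assms])
  fix z assume "Im z \<noteq> 0"
  then show "U z \<in> L2 (ereal c) b"
    using weyl_solution_in_domain[of z] weyl_solution_solution[of z] c
    by (auto simp: in_domain_near_right_def solution_def intro: L2_right tau_eq_continuous)
qed auto

lemma wronskian_weyl_solution:
  assumes "solution a b q z f" and "x \<in> einterval a b"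
  shows "wronskian f (U z) x = f c * m z - vderiv f c"
  using wronskian_solutions_const[OF assms(1) weyl_solution_solution assms(2) c]
  by (simp add: wronskian_def weyl_solution_at_c)

end

theorem lemma2p6:
  fixes a b :: ereal and q :: "real \<Rightarrow> real" and v w :: "real \<Rightarrow> complex"
    and c x :: real and \<phi> \<theta> C S u :: "complex \<Rightarrow> real \<Rightarrow> complex"
  assumes q: "loc_integrable a b q"
    and v: "bc_function_left a b q v" and w: "bc_function_right a b q w"
    and H: "self_adjoint a b (H_op a b q v w)"
    and c: "c \<in> einterval a b"
    and discrete: "purely_discrete a (ereal c) (H_Dirichlet_left a b q v c)"
    and C: "\<And>z. solution a b q z (C z) \<and> C z c = 1 \<and> vderiv (C z) c = 0"
    and S: "\<And>z. solution a b q z (S z) \<and> S z c = 0 \<and> vderiv (S z) c = 1"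
    and \<phi>: "real_entire_solution a b q \<phi>" and \<theta>: "real_entire_solution a b q \<theta>"
    and \<phi>_dom: "\<And>z. in_domain_near_left a b q v (\<phi> z)"
    and W: "\<And>z y. y \<in> einterval a b \<Longrightarrow> wronskian (\<theta> z) (\<phi> z) y = 1"
    and u: "u = weyl_solution a b q w C S"
    and x: "x \<in> einterval a b"
  shows "(\<forall>z\<in>- \<real>. wronskian (\<phi> z) (u z) x \<noteq> 0) \<and>
    singular_weyl_m \<phi> \<theta> u x analytic_on - \<real> \<and>
    (\<forall>z\<in>- \<real>. singular_weyl_m \<phi> \<theta> u x z = cnj (singular_weyl_m \<phi> \<theta> u x (cnj z)))"
proof -
  interpret weyl_setup a b q c C S v w
    by unfold_locales (use c C S H w in auto)
  have nonreal: "z \<in> - \<real> \<longleftrightarrow> Im z \<noteq> 0" for z by (simp add: complex_is_Real_iff)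
  have sol: "solution a b q z (\<phi> z)" "solution a b q z (\<theta> z)" for z
    using \<phi> \<theta> by (auto simp: real_entire_solution_def)
  have entire: "real_entire (\<lambda>z. \<phi> z c)" "real_entire (\<lambda>z. vderiv (\<phi> z) c)"
    "real_entire (\<lambda>z. \<theta> z c)" "real_entire (\<lambda>z. vderiv (\<theta> z) c)"
    using \<phi> \<theta> c by (auto simp: real_entire_solution_def)
  have ne: "wronskian (\<phi> z) (u z) x \<noteq> 0" if z: "Im z \<noteq> 0" for z
  proof
    assume "wronskian (\<phi> z) (u z) x = 0"
    then have d\<phi>: "vderiv (\<phi> z) c = \<phi> z c * m z"
      using wronskian_weyl_solution[OF sol(1) x, of z] by (simp add: u)
    \<comment> \<open>The vanishing Wronskian makes \<open>\<phi> z\<close> a multiple of the Weyl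
      solution. The zero term gives it the shape of the combination lemma, applied to two copies of
      \<open>U z\<close>.\<close>
    have "\<phi> z c * U z y + 0 * U z y = \<phi> z y" if "y \<in> einterval a b" for y
      using solution_expand[OF sol(1) that] d\<phi> by (simp add: weyl_solution_def algebra_simps)
    then have "in_domain_near_right a b q w (\<phi> z)"
      using in_domain_near_right_cong[OF _ c in_domain_near_right_lincomb[OF
            weyl_solution_solution weyl_solution_in_domain[OF z] weyl_solution_solution weyl_solution_in_domain[OF z] c]]
      by blast
    \<comment> \<open>Now \<open>\<phi> z\<close> satisfies the conditions at both ends, hence
      vanishes. By \<open>d\<phi>\<close> its derivative at \<open>c\<close> vanishes too, against
      the normalization of the Wronskian with \<open>\<theta> z\<close>.\<close>
    then have "\<phi> z c = 0" by (rule eigenfunction_zero[OF H z sol(1) \<phi>_dom _ c])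
    then show False using W[OF c, of z] d\<phi> by (simp add: wronskian_def)
  qed
  have M: "singular_weyl_m \<phi> \<theta> u x z =
      - (\<theta> z c * m z - vderiv (\<theta> z) c) / (\<phi> z c * m z - vderiv (\<phi> z) c)" for z
    unfolding singular_weyl_m_def u
    by (simp only: wronskian_weyl_solution[OF sol(1) x] wronskian_weyl_solution[OF sol(2) x])
  have ne': "\<phi> z c * m z - vderiv (\<phi> z) c \<noteq> 0" if "z \<in> - \<real>" for z
    using ne[of z] that wronskian_weyl_solution[OF sol(1) x, of z] by (simp add: u nonreal del: Compl_iff)
  have hol_m: "m holomorphic_on - \<real>"
    unfolding holomorphic_on_def
    using weyl_m_differentiable nonreal by (auto intro: field_differentiable_at_within)
  have hol: "(\<lambda>z. \<phi> z c) holomorphic_on - \<real>" "(\<lambda>z. vderiv (\<phi> z) c) holomorphic_on - \<real>"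
    "(\<lambda>z. \<theta> z c) holomorphic_on - \<real>" "(\<lambda>z. vderiv (\<theta> z) c) holomorphic_on - \<real>"
    using entire by (auto simp: real_entire_def intro: holomorphic_on_subset)
  have "(\<lambda>z. - (\<theta> z c * m z - vderiv (\<theta> z) c) / (\<phi> z c * m z - vderiv (\<phi> z) c)) holomorphic_on - \<real>"
    by (intro holomorphic_intros hol hol_m ne')
  then have "singular_weyl_m \<phi> \<theta> u x holomorphic_on - \<real>"
    by (simp add: M[abs_def] fun_eq_iff cong: holomorphic_cong)
  moreover have "open (- \<real> :: complex set)"
    using closed_complex_Reals by (rule open_Compl)
  ultimately have "singular_weyl_m \<phi> \<theta> u x analytic_on - \<real>"
    by (simp add: analytic_on_open)
  moreover have "singular_weyl_m \<phi> \<theta> u x z = cnj (singular_weyl_m \<phi> \<theta> u x (cnj z))" if "Im z \<noteq> 0" for z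
    unfolding M using entire[THEN real_entire_cnj, of z] weyl_m_cnj[OF that] by simp
  ultimately show ?thesis using ne nonreal by blast
qed

end
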